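(* Let $(\Omega,\mathcal A,\mu)$ be a non-atomic Lebesgue probability space and let $T$ be an ergodic invertible measure preserving transformation of $\Omega$. Let $(a_n)_{n\in\mathbb N}\subset\mathbb R_+$ be an increasing sequence such that $a_n\nearrow\infty$ and $\frac{a_n}{n}\to 0$ as $n\to\infty$. Then there exists a $\Theta$-dense $G_\delta$ subset of $\mathcal A$ such that every set $A$ belonging to it has the following property: for every probability measure $\nu$ on $\mathbb R$, there exists a subsequence $(n_k)_{k\in\mathbb N}$ such that $$\frac{1}{a_{n_k}}S_{n_k}(\mathbf 1_A-\mu(A))\;\xrightarrow[\;k\to\infty\;]{\mathcal D}\;\nu .$$
   Context: For a function $f:\Omega\to\mathbb R$, $S_n(f)=\sum_{i=0}^{n-1} f\circ T^i$. The $\sigma$-algebra $\mathcal A$ is equipped with the pseudo-metric $\Theta(A,B)=\mu(A\triangle B)$, $A,B\in\mathcal A$; "dense" and "$G_\delta$" refer to the topology on $\mathcal A$ induced by $\Theta$. The notation $X_n\xrightarrow{\mathcal D}\nu$ means that the real random variables $X_n$ (on $(\Omega,\mathcal A,\mu)$) converge in distribution to a real random variable having distribution $\nu$. $\mathbf 1_A$ is the indicator function of $A$. *)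

theory Defs
  imports "HOL-Probability.Probability"
begin

definition isomorphic_mod0 :: "'a measure \<Rightarrow> 'b measure \<Rightarrow> bool" where
  "isomorphic_mod0 M N \<longleftrightarrow>
     (\<exists>A \<in> null_sets M. \<exists>B \<in> null_sets N. \<exists>\<phi>.
        bij_betw \<phi> (space M - A) (space N - B) \<and>
        \<phi> \<in> measurable (restrict_space M (space M - A)) (restrict_space N (space N - B)) \<and>
        the_inv_into (space M - A) \<phi>
          \<in> measurable (restrict_space N (space N - B)) (restrict_space M (space M - A)) \<and>
        distr (restrict_space M (space M - A)) (restrict_space N (space N - B)) \<phi>
          = restrict_space N (space N - B))"

text \<open>Rokhlin's definition: a complete probability space that is isomorphic mod 0 to the disjoint
  union of an interval with Lebesgue measure and at most countably many atoms. The model is placed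
  on the real line, as the interval from \<open>0\<close> to \<open>s\<close> and atoms of mass \<open>p i\<close> at the points
  \<open>-1, -2, -3, \<dots>\<close>; the values \<open>s = 0\<close> and \<open>p i = 0\<close> are allowed.\<close>

definition lebesgue_prob_space :: "'a measure \<Rightarrow> bool" where
  "lebesgue_prob_space M \<longleftrightarrow>
     prob_space M \<and> complete_measure M \<and>
     (\<exists>(N :: real measure) s p.
        0 \<le> s \<and> (\<forall>i::nat. 0 \<le> p i) \<and>
        sets N = sets borel \<and>
        (\<forall>B \<in> sets borel. emeasure N B =
           emeasure lborel (B \<inter> {0..s}) + (\<Sum>i. ennreal (p i) * indicator B (- real (Suc i)))) \<and>
        isomorphic_mod0 M (completion N))"

definition non_atomic :: "'a measure \<Rightarrow> bool" where
  "non_atomic M \<longleftrightarrow>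
     \<not> (\<exists>A \<in> sets M. emeasure M A > 0 \<and>
          (\<forall>B \<in> sets M. B \<subseteq> A \<longrightarrow> emeasure M B = 0 \<or> emeasure M (A - B) = 0))"

definition invertible_measure_preserving :: "'a measure \<Rightarrow> ('a \<Rightarrow> 'a) \<Rightarrow> bool" where
  "invertible_measure_preserving M T \<longleftrightarrow>
     bij_betw T (space M) (space M) \<and>
     T \<in> measurable M M \<and> the_inv_into (space M) T \<in> measurable M M \<and>
     (\<forall>A \<in> sets M. emeasure M (T -` A \<inter> space M) = emeasure M A)"

definition ergodic :: "'a measure \<Rightarrow> ('a \<Rightarrow> 'a) \<Rightarrow> bool" where
  "ergodic M T \<longleftrightarrow>
     (\<forall>A \<in> sets M. T -` A \<inter> space M = A \<longrightarrow> measure M A = 0 \<or> measure M A = 1)"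

definition birkhoff_sum :: "('a \<Rightarrow> 'a) \<Rightarrow> ('a \<Rightarrow> real) \<Rightarrow> nat \<Rightarrow> 'a \<Rightarrow> real" where
  "birkhoff_sum T f n x = (\<Sum>i<n. f ((T ^^ i) x))"

definition Theta :: "'a measure \<Rightarrow> 'a set \<Rightarrow> 'a set \<Rightarrow> real" where
  "Theta M A B = measure M (sym_diff A B)"

text \<open>\<open>Theta M\<close> is only a pseudo-metric on \<open>sets M\<close>, so \<open>Metric_space\<close> does not apply.\<close>

definition Theta_topology :: "'a measure \<Rightarrow> 'a set topology" where
  "Theta_topology M = topology (\<lambda>U. U \<subseteq> sets M \<and>
     (\<forall>A \<in> U. \<exists>e>0. \<forall>B \<in> sets M. Theta M A B < e \<longrightarrow> B \<in> U))"

lemma openin_Theta_topology: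
  "openin (Theta_topology M) U \<longleftrightarrow>
     U \<subseteq> sets M \<and> (\<forall>A \<in> U. \<exists>e>0. \<forall>B \<in> sets M. Theta M A B < e \<longrightarrow> B \<in> U)"
proof -
  let ?P = "\<lambda>U. U \<subseteq> sets M \<and> (\<forall>A \<in> U. \<exists>e>0. \<forall>B \<in> sets M. Theta M A B < e \<longrightarrow> B \<in> U)"
  have int: "?P (S \<inter> S')" if S: "?P S" and S': "?P S'" for S S'
  proof (intro conjI ballI)
    show "S \<inter> S' \<subseteq> sets M" using S by blast
    fix A assume A: "A \<in> S \<inter> S'"
    obtain e where e: "e > 0" "\<forall>B \<in> sets M. Theta M A B < e \<longrightarrow> B \<in> S"
      using S A by blast
    obtain e' where e': "e' > 0" "\<forall>B \<in> sets M. Theta M A B < e' \<longrightarrow> B \<in> S'"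
      using S' A by blast
    show "\<exists>e>0. \<forall>B \<in> sets M. Theta M A B < e \<longrightarrow> B \<in> S \<inter> S'"
      using e e' by (intro exI[of _ "min e e'"]) auto
  qed
  have Un: "?P (\<Union>\<K>)" if K: "\<And>K. K \<in> \<K> \<Longrightarrow> ?P K" for \<K>
  proof (intro conjI ballI)
    show "\<Union>\<K> \<subseteq> sets M" using K by blast
    fix A assume "A \<in> \<Union>\<K>"
    then obtain S where S: "S \<in> \<K>" "A \<in> S" by blast
    obtain e where "e > 0" "\<forall>B \<in> sets M. Theta M A B < e \<longrightarrow> B \<in> S"
      using K[OF S(1)] S(2) by blast
    with S(1) show "\<exists>e>0. \<forall>B \<in> sets M. Theta M A B < e \<longrightarrow> B \<in> \<Union>\<K>"
      by (intro exI[of _ e]) auto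
  qed
  have "istopology ?P"
    unfolding istopology_def
    by (rule conjI; intro allI impI) (rule int, assumption+, rule Un, erule bspec)
  then show ?thesis
    unfolding Theta_topology_def by (simp add: topology_inverse')
qed

lemma topspace_Theta_topology [simp]: "topspace (Theta_topology M) = sets M"
proof (rule antisym)
  show "topspace (Theta_topology M) \<subseteq> sets M"
    by (metis openin_Theta_topology openin_topspace)
  have "openin (Theta_topology M) (sets M)"
    unfolding openin_Theta_topology by (auto intro: exI[of _ 1])
  then show "sets M \<subseteq> topspace (Theta_topology M)"
    by (rule openin_subset)
qed

end

theory Submission
  imports Defs
begin

text \<open>By the Baire category theorem for the complete pseudo-metric \<open>\<Theta>\<close> it suffices to show, for each
  member \<open>l\<close> of a countable weakly dense family of centred laws, that a given set \<open>A\<close> can be changed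
  on a set of small measure so that, for some large \<open>n\<close>, the law of the normalized sum is close to
  \<open>l\<close>. Choose a set \<open>E\<close> of tiny measure and let \<open>Y\<close> be a random variable with law \<open>l\<close> that is constant
  along the orbit pieces between consecutive visits to \<open>E\<close>. Along each piece, follow the bits of \<open>A\<close>
  and flip one only when the discrepancy between their partial sums and a line of slope
  \<open>\<theta> = c + a\<^sub>n Y / n\<close> would leave a fixed strip. The resulting set \<open>B\<close> satisfies
  \<open>S\<^sub>n 1\<^sub>B = n c + a\<^sub>n Y + O(1)\<close> off a small set, and since \<open>Y\<close> is centred \<open>n \<mu>(B) = n c + o(a\<^sub>n)\<close>.
  Because \<open>c\<close> is close to \<open>\<mu>(A)\<close> and \<open>a\<^sub>n / n\<close> is small, the ergodic theorem makes flips rare.\<close>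

section \<open>Birkhoff sums and the ergodic theorem\<close>

lemma birkhoff_sum_0 [simp]: "birkhoff_sum T f 0 x = 0"
  by (simp add: birkhoff_sum_def)

lemma birkhoff_sum_Suc_shift: "birkhoff_sum T f (Suc n) x = f x + birkhoff_sum T f n (T x)"
  unfolding birkhoff_sum_def
  by (subst sum.lessThan_Suc_shift) (simp add: funpow_swap1 del: funpow.simps add: funpow_Suc_right)

lemma birkhoff_sum_diff_const:
  "birkhoff_sum T (\<lambda>y. f y - c) n x = birkhoff_sum T f n x - real n * c"
  by (simp add: birkhoff_sum_def sum_subtractf)

locale mpt = prob_space M for M :: "'a measure" +
  fixes T :: "'a \<Rightarrow> 'a"
  assumes T_meas [measurable]: "T \<in> measurable M M"
    and T_pres: "distr M M T = M"
begin

lemma funpow_meas [measurable]: "(T ^^ i) \<in> measurable M M"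
  by (induction i) auto

lemma funpow_space [simp]: "x \<in> space M \<Longrightarrow> (T ^^ i) x \<in> space M"
  using measurable_space[OF funpow_meas] by blast

lemma T_space [simp]: "x \<in> space M \<Longrightarrow> T x \<in> space M"
  using measurable_space[OF T_meas] by blast

lemma funpow_pres: "distr M M (T ^^ i) = M"
proof (induction i)
  case 0
  show ?case by (simp add: id_def)
next
  case (Suc i)
  have "distr M M (T ^^ Suc i) = distr (distr M M (T ^^ i)) M T"
    by (subst distr_distr) (auto simp: comp_def)
  then show ?case by (simp only: Suc.IH T_pres)
qed

lemma integral_funpow:
  fixes f :: "'a \<Rightarrow> real"
  assumes [measurable]: "f \<in> borel_measurable M"
  shows "(\<integral>x. f ((T ^^ i) x) \<partial>M) = (\<integral>x. f x \<partial>M)"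
  by (subst (2) funpow_pres[of i, symmetric]) (simp add: integral_distr)

lemma integral_T:
  fixes f :: "'a \<Rightarrow> real"
  assumes "f \<in> borel_measurable M"
  shows "(\<integral>x. f (T x) \<partial>M) = (\<integral>x. f x \<partial>M)"
  using integral_funpow[OF assms, of 1] by simp

lemma prob_funpow:
  assumes [measurable]: "A \<in> sets M"
  shows "prob {x \<in> space M. (T ^^ i) x \<in> A} = prob A"
proof -
  have "prob A = measure (distr M M (T ^^ i)) A" by (simp add: funpow_pres)
  also have "\<dots> = prob ((T ^^ i) -` A \<inter> space M)" by (simp add: measure_distr)
  also have "(T ^^ i) -` A \<inter> space M = {x \<in> space M. (T ^^ i) x \<in> A}" by auto
  finally show ?thesis by simp
qed

lemma birkhoff_sum_meas [measurable]:
  assumes [measurable]: "f \<in> borel_measurable M"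
  shows "birkhoff_sum T f n \<in> borel_measurable M"
  unfolding birkhoff_sum_def[abs_def] by measurable

lemma integral_birkhoff_sum:
  fixes f :: "'a \<Rightarrow> real"
  assumes [measurable]: "f \<in> borel_measurable M" and "\<And>x. \<bar>f x\<bar> \<le> C"
  shows "(\<integral>x. birkhoff_sum T f n x \<partial>M) = n * (\<integral>x. f x \<partial>M)"
proof -
  have "integrable M (\<lambda>x. f ((T ^^ i) x))" for i
    by (rule integrable_const_bound[where B=C]) (use assms(2) in auto)
  then show ?thesis
    unfolding birkhoff_sum_def by (subst Bochner_Integration.integral_sum) (auto simp: integral_funpow)
qed

text \<open>The maximum of the Birkhoff sums of lengths 0 to \<open>N\<close>, written as a
  recursion along the orbit so that Garsia's inequality follows by unfolding.\<close>

fun maximal :: "('a \<Rightarrow> real) \<Rightarrow> nat \<Rightarrow> 'a \<Rightarrow> real" where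
  "maximal f 0 x = 0"
| "maximal f (Suc N) x = max 0 (f x + maximal f N (T x))"

lemma maximal_nonneg: "0 \<le> maximal f N x"
  by (cases N) auto

lemma maximal_mono_Suc: "maximal f N x \<le> maximal f (Suc N) x"
proof (induction N arbitrary: x)
  case (Suc N)
  show ?case using Suc[of "T x"] by (auto simp: max_def)
qed auto

lemma birkhoff_sum_le_maximal: "k \<le> N \<Longrightarrow> birkhoff_sum T f k x \<le> maximal f N x"
proof (induction N arbitrary: x k)
  case (Suc N)
  show ?case
  proof (cases k)
    case (Suc j)
    with Suc.prems Suc.IH[of j "T x"] show ?thesis by (auto simp: birkhoff_sum_Suc_shift)
  qed (simp add: maximal_nonneg)
qed auto

lemma maximal_meas [measurable]:
  assumes [measurable]: "f \<in> borel_measurable M"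
  shows "maximal f N \<in> borel_measurable M"
proof (induction N)
  case 0
  then show ?case by (simp add: fun_eq_iff[symmetric])
next
  case (Suc N)
  note [measurable] = Suc
  show ?case by (simp only: maximal.simps[abs_def]) measurable
qed

lemma maximal_bound:
  assumes "\<And>x. \<bar>f x\<bar> \<le> C"
  shows "\<bar>maximal f N x\<bar> \<le> N * C"
proof (induction N arbitrary: x)
  case (Suc N)
  show ?case using Suc[of "T x"] assms[of x] by (auto simp: algebra_simps)
qed auto

text \<open>Garsia's proof: where \<open>maximal f N\<close> is positive, it is at most \<open>f + maximal f N \<circ> T\<close>.\<close>

lemma maximal_ergodic:
  assumes [measurable]: "f \<in> borel_measurable M" and C: "\<And>x. \<bar>f x\<bar> \<le> C"
  shows "0 \<le> (\<integral>x. f x * indicator {x \<in> space M. maximal f N x > 0} x \<partial>M)"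
proof (cases N)
  case 0
  then show ?thesis by simp
next
  case (Suc m)
  have int: "integrable M (\<lambda>x. maximal f N x)" "integrable M (\<lambda>x. maximal f N (T x))"
    by (rule integrable_const_bound[where B="N * C"]; use maximal_bound[of f C, OF C] in auto)+
  have "0 = (\<integral>x. maximal f N x \<partial>M) - (\<integral>x. maximal f N (T x) \<partial>M)"
    by (simp add: integral_T)
  also have "\<dots> = (\<integral>x. maximal f N x - maximal f N (T x) \<partial>M)"
    by (rule Bochner_Integration.integral_diff[OF int, symmetric])
  also have "\<dots> \<le> (\<integral>x. f x * indicator {x \<in> space M. maximal f N x > 0} x \<partial>M)"
  proof (rule integral_mono)
    show "integrable M (\<lambda>x. f x * indicator {x \<in> space M. maximal f N x > 0} x)"
      by (rule integrable_const_bound[where B=C])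
        (use C order_trans[OF abs_ge_zero C] in \<open>auto simp: indicator_def abs_mult\<close>)
    fix x assume "x \<in> space M"
    then show "maximal f N x - maximal f N (T x) \<le> f x * indicator {x \<in> space M. maximal f N x > 0} x"
      using maximal_mono_Suc[of f m "T x"] maximal_nonneg[of f N "T x"] maximal_nonneg[of f N "x"] Suc
      by (auto simp: indicator_def max_def)
  qed (use int in auto)
  finally show ?thesis .
qed

text \<open>The sets where \<open>maximal f N\<close> is positive increase to a set of full measure,
  so dominated convergence carries the maximal inequality over to the whole space.\<close>

lemma integral_nonneg_of_birkhoff_sum_pos:
  assumes [measurable]: "f \<in> borel_measurable M" and C: "\<And>x. \<bar>f x\<bar> \<le> C"
    and pos: "AE x in M. \<exists>k. birkhoff_sum T f k x > 0"
  shows "0 \<le> (\<integral>x. f x \<partial>M)"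
proof -
  have "(\<lambda>N. \<integral>x. f x * indicator {x \<in> space M. maximal f N x > 0} x \<partial>M) \<longlonglongrightarrow> (\<integral>x. f x \<partial>M)"
  proof (rule integral_dominated_convergence[where w="\<lambda>_. C"])
    show "AE x in M. (\<lambda>N. f x * indicator {x \<in> space M. maximal f N x > 0} x) \<longlonglongrightarrow> f x"
      using pos AE_space
    proof eventually_elim
      case (elim x)
      then obtain k where k: "birkhoff_sum T f k x > 0" by auto
      have "eventually (\<lambda>N. f x * indicator {x \<in> space M. maximal f N x > 0} x = f x) sequentially"
        using eventually_ge_at_top[of k]
      proof eventually_elim
        case (elim N)
        with birkhoff_sum_le_maximal[of k N f x] k \<open>x \<in> space M\<close> show ?case by auto
      qed
      then show ?case by (rule tendsto_eventually)
    qed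
    show "AE x in M. norm (f x * indicator {x \<in> space M. maximal f N x > 0} x) \<le> C" for N
      using C order_trans[OF abs_ge_zero C] by (auto simp: indicator_def abs_mult)
  qed auto
  then show ?thesis
    by (rule LIMSEQ_le_const) (use maximal_ergodic[OF _ C] in auto)
qed

end

locale ergodic_mpt = mpt +
  assumes erg: "A \<in> sets M \<Longrightarrow> T -` A \<inter> space M = A \<Longrightarrow> prob A = 0 \<or> prob A = 1"
begin

text \<open>The upper half of the pointwise ergodic theorem for indicators. Exceeding a rate above
  the mean infinitely often is an invariant event; if it had full measure, the maximal inequality
  would give a function of negative mean a nonnegative integral.\<close>

lemma birkhoff_sum_eventually_le:
  assumes A [measurable]: "A \<in> sets M" and "\<eta> > 0"
  shows "AE x in M. eventually (\<lambda>k. birkhoff_sum T (indicator A) k x \<le> real k * (prob A + \<eta>)) sequentially"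
proof -
  define S where "S k x = birkhoff_sum T (indicator A) k x" for k x
  have [measurable]: "S k \<in> borel_measurable M" for k
    unfolding S_def by measurable
  \<comment> \<open>Half of \<eta> makes \<open>indicator A - \<alpha>\<close> have negative mean;
    the other half leaves room for a rational rate between \<alpha> and
    \<open>prob A + \<eta>\<close>.\<close>
  define \<alpha> where "\<alpha> = prob A + \<eta> / 2"
  \<comment> \<open>The upper limit of \<open>S k x / k\<close> exceeds \<alpha>; rational rates
    keep this event measurable.\<close>
  define Q where "Q x \<longleftrightarrow> (\<exists>\<beta>\<in>\<rat>. \<beta> > \<alpha> \<and> (\<forall>N. \<exists>k\<ge>N. S k x > real k * \<beta>))" for x
  define E where "E = {x \<in> space M. Q x}"
  have [measurable]: "E \<in> sets M"
    unfolding E_def Q_def Rats_def bex_simps by measurable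
  have QT: "Q x \<longleftrightarrow> Q (T x)" for x
  proof -
    have shift: "S (Suc k) x = indicator A x + S k (T x)" for k
      unfolding S_def by (rule birkhoff_sum_Suc_shift)
    have ind: "indicator A x \<le> (1::real)" by simp
    have arch: "\<exists>\<beta>'\<in>\<rat>. \<alpha> < \<beta>' \<and> \<beta>' < \<beta>" if "\<beta> > \<alpha>" for \<beta>
      using Rats_dense_in_real[OF that] by auto
    \<comment> \<open>Moving to the next point of the orbit changes the sum and its length by at
      most 1; lowering the rate from \<beta> to \<beta>' absorbs this for large
      \<open>k\<close>.\<close>
    have slack: "\<exists>k0. \<forall>k\<ge>k0. real k * \<beta> \<ge> real k * \<beta>' + \<bar>\<beta>\<bar> + \<bar>\<beta>'\<bar> + 1" if "\<beta>' < \<beta>" for \<beta> \<beta>' :: real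
    proof -
      obtain k0 :: nat where k0: "real k0 * (\<beta> - \<beta>') > \<bar>\<beta>\<bar> + \<bar>\<beta>'\<bar> + 1"
        using reals_Archimedean3[of "\<beta> - \<beta>'"] \<open>\<beta>' < \<beta>\<close> by fastforce
      have "real k * \<beta> \<ge> real k * \<beta>' + \<bar>\<beta>\<bar> + \<bar>\<beta>'\<bar> + 1" if "k \<ge> k0" for k
      proof -
        have "real k0 * (\<beta> - \<beta>') \<le> real k * (\<beta> - \<beta>')"
          using that \<open>\<beta>' < \<beta>\<close> by (intro mult_right_mono) auto
        with k0 show ?thesis by (simp add: algebra_simps)
      qed
      then show ?thesis by blast
    qed
    show ?thesis
    proof
      assume "Q x"
      then obtain \<beta> where b: "\<beta> > \<alpha>" "\<And>N. \<exists>k\<ge>N. S k x > real k * \<beta>" unfolding Q_def by blast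
      obtain \<beta>' where b': "\<beta>' \<in> \<rat>" "\<alpha> < \<beta>'" "\<beta>' < \<beta>" using arch[OF b(1)] by blast
      obtain k0 where k0: "\<And>k. k \<ge> k0 \<Longrightarrow> real k * \<beta> \<ge> real k * \<beta>' + \<bar>\<beta>\<bar> + \<bar>\<beta>'\<bar> + 1"
        using slack[OF b'(3)] by blast
      have "\<exists>k\<ge>N. S k (T x) > real k * \<beta>'" for N
      proof -
        obtain k where k: "k \<ge> Suc (N + k0)" "S k x > real k * \<beta>" using b(2) by blast
        then obtain j where j: "k = Suc j" by (cases k) auto
        have kj: "real k * \<beta>' = real j * \<beta>' + \<beta>'"
          unfolding j by (simp add: algebra_simps)
        have "S k x \<le> 1 + S j (T x)"
          using shift[of j] ind unfolding j by linarith
        then have "S j (T x) > real j * \<beta>'"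
          using k k0[of k] kj abs_ge_minus_self[of \<beta>'] by linarith
        with k j show ?thesis by (intro exI[of _ j]) auto
      qed
      with b' show "Q (T x)" unfolding Q_def by blast
    next
      assume "Q (T x)"
      then obtain \<beta> where b: "\<beta> > \<alpha>" "\<And>N. \<exists>k\<ge>N. S k (T x) > real k * \<beta>" unfolding Q_def by blast
      obtain \<beta>' where b': "\<beta>' \<in> \<rat>" "\<alpha> < \<beta>'" "\<beta>' < \<beta>" using arch[OF b(1)] by blast
      obtain k0 where k0: "\<And>k. k \<ge> k0 \<Longrightarrow> real k * \<beta> \<ge> real k * \<beta>' + \<bar>\<beta>\<bar> + \<bar>\<beta>'\<bar> + 1"
        using slack[OF b'(3)] by blast
      have "\<exists>k\<ge>N. S k x > real k * \<beta>'" for N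
      proof -
        obtain k where k: "k \<ge> N + k0" "S k (T x) > real k * \<beta>" using b(2) by blast
        have "S (Suc k) x > real (Suc k) * \<beta>'"
          using k k0[of k] shift[of k] by (auto simp: indicator_def algebra_simps split: if_splits)
        with k show ?thesis by (intro exI[of _ "Suc k"]) auto
      qed
      with b' show "Q x" unfolding Q_def by blast
    qed
  qed
  have "T -` E \<inter> space M = E"
    unfolding E_def by (auto simp: QT[symmetric])
  then have "prob E = 0 \<or> prob E = 1" by (intro erg) auto
  moreover have "prob E \<noteq> 1"
  proof
    assume "prob E = 1"
    then have "AE x in M. x \<in> E" by (simp add: prob_eq_1)
    then have "AE x in M. \<exists>k. birkhoff_sum T (\<lambda>y. indicator A y - \<alpha>) k x > 0"
    proof eventually_elim
      case (elim x)
      then obtain \<beta> where "\<beta> > \<alpha>" "\<forall>N. \<exists>k\<ge>N. S k x > real k * \<beta>" unfolding E_def Q_def by blast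
      then obtain k where k: "k \<ge> 1" "S k x > real k * \<beta>" by blast
      have "real k * \<beta> > real k * \<alpha>" using \<open>\<beta> > \<alpha>\<close> k by auto
      with k(2) show ?case unfolding S_def by (auto simp: birkhoff_sum_diff_const intro!: exI[of _ k])
    qed
    then have "0 \<le> (\<integral>x. indicator A x - \<alpha> \<partial>M)"
      by (rule integral_nonneg_of_birkhoff_sum_pos[rotated 2, where C="1 + \<bar>\<alpha>\<bar>"])
        (auto simp: indicator_def)
    also have "\<dots> = prob A - \<alpha>"
      by (subst Bochner_Integration.integral_diff) (auto simp: prob_space emeasure_eq_measure)
    finally show False using \<open>\<eta> > 0\<close> unfolding \<alpha>_def by simp
  qed
  ultimately have "prob E = 0" by blast
  then have "AE x in M. x \<notin> E"
    by (intro AE_not_in) (auto simp: null_sets_def emeasure_eq_measure)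
  then show ?thesis using AE_space
  proof eventually_elim
    case (elim x)
    obtain \<beta> where b: "\<beta> \<in> \<rat>" "\<alpha> < \<beta>" "\<beta> < prob A + \<eta>"
      using Rats_dense_in_real[of \<alpha> "prob A + \<eta>"] \<open>\<eta> > 0\<close> unfolding \<alpha>_def by auto
    have "\<exists>N. \<forall>k\<ge>N. S k x \<le> real k * \<beta>"
      using elim b unfolding E_def Q_def by (simp add: not_less) (metis not_le)
    then obtain N where N: "\<And>k. k \<ge> N \<Longrightarrow> S k x \<le> real k * \<beta>" by blast
    have le: "real k * \<beta> \<le> real k * (prob A + \<eta>)" for k
      using b by (intro mult_left_mono) auto
    show ?case
      unfolding eventually_sequentially S_def[symmetric]
      by (intro exI[of _ N] allI impI order_trans[OF N le])
  qed
qed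

text \<open>The one-sided bound for \<open>A\<close> and for its complement gives two-sided
  convergence; continuity from above then gives a common starting time off a small set. Shorter sums
  deviate by a bounded amount, negligible on the scale \<open>b\<close>.\<close>

lemma birkhoff_sum_uniform_close:
  assumes A [measurable]: "A \<in> sets M" and \<eta>: "\<eta> > 0"
  shows "\<exists>b0. \<forall>b\<ge>b0. prob {x \<in> space M. \<exists>k\<le>b. \<bar>birkhoff_sum T (indicator A) k x - real k * prob A\<bar> > \<eta> * real b} < \<eta>"
proof -
  define S where "S k x = birkhoff_sum T (indicator A) k x" for k x
  have [measurable]: "S k \<in> borel_measurable M" for k
    unfolding S_def by measurable
  define W where "W m = {x \<in> space M. \<exists>k\<ge>m. \<bar>S k x - real k * prob A\<bar> > \<eta> * real k}" for m
  have [measurable]: "W m \<in> sets M" for m unfolding W_def by measurable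
  have compl: "S k x + birkhoff_sum T (indicator (space M - A)) k x = real k" if "x \<in> space M" for k x
  proof -
    have "(\<Sum>i<k. indicator A ((T ^^ i) x) + indicator (space M - A) ((T ^^ i) x)) = (\<Sum>i<k. 1::real)"
      by (rule sum.cong) (use that in \<open>auto simp: indicator_def\<close>)
    then show ?thesis unfolding S_def birkhoff_sum_def by (simp add: sum.distrib)
  qed
  have "AE x in M. x \<notin> (\<Inter>m. W m)"
    using birkhoff_sum_eventually_le[OF A \<eta>]
      birkhoff_sum_eventually_le[of "space M - A", OF _ \<eta>, simplified] AE_space
  proof eventually_elim
    case (elim x)
    have "eventually (\<lambda>k. \<bar>S k x - real k * prob A\<bar> \<le> \<eta> * real k) sequentially"
      using elim(1,2)
    proof eventually_elim
      case (elim k)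
      with compl[OF \<open>x \<in> space M\<close>, of k] show ?case
        unfolding S_def[symmetric] by (auto simp: prob_compl algebra_simps abs_le_iff)
    qed
    then obtain m where "\<forall>k\<ge>m. \<bar>S k x - real k * prob A\<bar> \<le> \<eta> * real k"
      unfolding eventually_sequentially by blast
    then have "x \<notin> W m" unfolding W_def by auto
    then show ?case by blast
  qed
  then have "prob (\<Inter>m. W m) = 0"
    by (subst prob_eq_0) auto
  moreover have "(\<lambda>m. prob (W m)) \<longlonglongrightarrow> prob (\<Inter>m. W m)"
    by (rule finite_Lim_measure_decseq) (auto simp: decseq_def W_def intro: order_trans)
  ultimately have "eventually (\<lambda>m. prob (W m) < \<eta>) sequentially"
    using \<eta> by (auto dest: order_tendstoD)
  then obtain m where m: "prob (W m) < \<eta>" by (auto simp: eventually_sequentially)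
  \<comment> \<open>Sums of fewer than \<open>m\<close> terms deviate by at most their length, hence
    by at most \<open>\<eta> * b\<close> once \<open>\<eta> * b\<close> exceeds
    \<open>m\<close>.\<close>
  obtain b0 :: nat where b0: "real b0 * \<eta> > real m" using reals_Archimedean3[OF \<eta>] by blast
  have Sb: "0 \<le> S k x" "S k x \<le> real k" for k x
    unfolding S_def birkhoff_sum_def
    using sum_bounded_above[of "{..<k}" "\<lambda>i. indicator A ((T ^^ i) x)" "1::real"]
    by (auto intro!: sum_nonneg)
  have "prob {x \<in> space M. \<exists>k\<le>b. \<bar>S k x - real k * prob A\<bar> > \<eta> * real b} < \<eta>" if "b \<ge> b0" for b
  proof -
    have "{x \<in> space M. \<exists>k\<le>b. \<bar>S k x - real k * prob A\<bar> > \<eta> * real b} \<subseteq> W m"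
    proof safe
      fix x k assume x: "x \<in> space M" and k: "k \<le> b" "\<bar>S k x - real k * prob A\<bar> > \<eta> * real b"
      have "\<not> k < m"
      proof
        assume "k < m"
        have "real k * prob A \<le> real k * 1" by (intro mult_left_mono) auto
        then have "\<bar>S k x - real k * prob A\<bar> \<le> real k"
          using Sb[of k x] mult_nonneg_nonneg[OF of_nat_0_le_iff measure_nonneg, of k M A]
          unfolding abs_le_iff by linarith
        also have "\<dots> \<le> real b0 * \<eta>" using b0 \<open>k < m\<close> by simp
        also have "\<dots> \<le> real b * \<eta>" using that \<eta> by (intro mult_right_mono) auto
        finally show False using k by (simp add: mult.commute)
      qed
      moreover have "\<eta> * real k \<le> \<eta> * real b" using k \<eta> by (intro mult_left_mono) auto
      ultimately show "x \<in> W m" unfolding W_def using x k by (intro CollectI conjI exI[of _ k]) linarith+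
    qed
    then show ?thesis using m by (intro le_less_trans[OF finite_measure_mono m]) auto
  qed
  then show ?thesis unfolding S_def by blast
qed

end

section \<open>Steering a sequence of bits\<close>

text \<open>Here \<open>d\<close> is the current discrepancy and \<alpha> the proposed bit, which is
  overridden only if accepting it would take the discrepancy out of \<open>[-L, L]\<close>.\<close>

definition steer :: "real \<Rightarrow> real \<Rightarrow> real \<Rightarrow> real \<Rightarrow> real" where
  "steer L \<theta> d \<alpha> = (if d + \<alpha> - \<theta> > L then 0 else if d + \<alpha> - \<theta> < - L then 1 else \<alpha>)"

fun disc :: "real \<Rightarrow> real \<Rightarrow> (nat \<Rightarrow> real) \<Rightarrow> nat \<Rightarrow> real" where
  "disc L \<theta> \<alpha> 0 = 0"
| "disc L \<theta> \<alpha> (Suc k) = disc L \<theta> \<alpha> k + steer L \<theta> (disc L \<theta> \<alpha> k) (\<alpha> k) - \<theta>"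

definition steered :: "real \<Rightarrow> real \<Rightarrow> (nat \<Rightarrow> real) \<Rightarrow> nat \<Rightarrow> real" where
  "steered L \<theta> \<alpha> k = steer L \<theta> (disc L \<theta> \<alpha> k) (\<alpha> k)"

lemma disc_Suc: "disc L \<theta> \<alpha> (Suc k) = disc L \<theta> \<alpha> k + steered L \<theta> \<alpha> k - \<theta>"
  by (simp add: steered_def)

declare disc.simps(2) [simp del]

lemma steered_01: "\<alpha> k \<in> {0, 1} \<Longrightarrow> steered L \<theta> \<alpha> k \<in> {0, 1}"
  by (auto simp: steered_def steer_def)

text \<open>An override happens only next to a boundary and leaves the discrepancy within 1 of it;
  \<open>1 \<le> L\<close> keeps this inside the strip.\<close>

lemma abs_disc_le:
  assumes "\<And>k. \<alpha> k \<in> {0, 1}" "0 \<le> \<theta>" "\<theta> \<le> 1" "1 \<le> L"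
  shows "\<bar>disc L \<theta> \<alpha> k\<bar> \<le> L"
proof (induction k)
  case (Suc k)
  then show ?case
    using assms(1)[of k] assms(2-) by (auto simp: disc_Suc steered_def steer_def abs_le_iff)
qed (use assms in auto)

text \<open>Telescoping from an arbitrary height \<open>r\<close>; together with
  \<open>abs_disc_le\<close> it gives \<open>n * \<theta>\<close> up to an error
  \<open>2 * L\<close>.\<close>

lemma sum_steered:
  "(\<Sum>i<n. steered L \<theta> \<alpha> (r + i)) = real n * \<theta> + disc L \<theta> \<alpha> (r + n) - disc L \<theta> \<alpha> r"
  by (induction n) (auto simp: disc_Suc algebra_simps)

text \<open>Swapping 0 and 1 reflects the strip; this symmetry reduces windows that start below zero
  to windows that start above.\<close>

lemma steer_compl: "0 \<le> L \<Longrightarrow> steer L (1 - \<theta>) (- d) (1 - \<alpha>) = 1 - steer L \<theta> d \<alpha>"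
  by (auto simp: steer_def)

lemma disc_compl: "0 \<le> L \<Longrightarrow> disc L (1 - \<theta>) (\<lambda>i. 1 - \<alpha> i) k = - disc L \<theta> \<alpha> k"
  by (induction k) (auto simp: disc.simps(2) steer_compl)

lemma steered_compl: "0 \<le> L \<Longrightarrow> steered L (1 - \<theta>) (\<lambda>i. 1 - \<alpha> i) k = 1 - steered L \<theta> \<alpha> k"
  by (simp add: steered_def disc_compl steer_compl)

text \<open>In a window of length at most \<open>L\<close> the discrepancy can leave the strip on one side only,
  so the corrections there do not cancel and are counted by the discrepancy of \<open>\<alpha>\<close>.\<close>

lemma corrections_le_aux:
  assumes \<alpha>: "\<And>k. \<alpha> k \<in> {0, 1}" and \<theta>: "0 \<le> \<theta>" "\<theta> \<le> 1" and L: "real b \<le> L" "1 \<le> L"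
    and C: "\<And>m. m \<le> b \<Longrightarrow> \<bar>(\<Sum>i<m. \<alpha> (r + i)) - real m * \<theta>\<bar> \<le> C"
    and pos: "0 \<le> disc L \<theta> \<alpha> r"
  shows "(\<Sum>i<b. \<bar>steered L \<theta> \<alpha> (r + i) - \<alpha> (r + i)\<bar>) \<le> C + 1"
proof -
  define U where "U j = (\<Sum>i<j. \<bar>steered L \<theta> \<alpha> (r + i) - \<alpha> (r + i)\<bar>)" for j
  define X where "X j = (\<Sum>i<j. \<alpha> (r + i)) - real j * \<theta>" for j
  define d where "d j = disc L \<theta> \<alpha> (r + j)" for j
  \<comment> \<open>The identity for \<open>d j\<close> holds because every override so far turns a
    1 into a 0. The bound \<open>- real j\<close> rules out overrides at the lower boundary.\<close>
  have "U j \<le> C + 1 \<and> d j = d 0 + X j - U j \<and> d j \<ge> - real j" if "j \<le> b" for j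
    using that
  proof (induction j)
    case 0
    then show ?case using C[of 0] pos by (simp add: U_def X_def d_def)
  next
    case (Suc j)
    then have IH: "U j \<le> C + 1" "d j = d 0 + X j - U j" "d j \<ge> - real j" and j: "Suc j \<le> b" by auto
    have dL: "\<bar>d j\<bar> \<le> L" "\<bar>d 0\<bar> \<le> L" unfolding d_def by (intro abs_disc_le assms)+
    have jb: "real j + 1 \<le> L" using j L by linarith
    have a: "\<alpha> (r + j) = 0 \<or> \<alpha> (r + j) = 1" using \<alpha>[of "r + j"] by auto
    have dS: "d (Suc j) = d j + steered L \<theta> \<alpha> (r + j) - \<theta>" by (simp add: d_def disc_Suc)
    have XS: "X (Suc j) = X j + \<alpha> (r + j) - \<theta>" by (simp add: X_def algebra_simps)
    have US: "U (Suc j) = U j + \<bar>steered L \<theta> \<alpha> (r + j) - \<alpha> (r + j)\<bar>" by (simp add: U_def)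
    have nolow: "\<not> d j + \<alpha> (r + j) - \<theta> < - L" using IH(3) a \<theta> jb by linarith
    have XC: "X (Suc j) \<le> C" using C[OF j] by (simp add: X_def)
    show ?case
    proof (cases "d j + \<alpha> (r + j) - \<theta> > L")
      case True
      then have s: "steered L \<theta> \<alpha> (r + j) = 0" by (simp add: steered_def steer_def d_def)
      have a1: "\<alpha> (r + j) = 1" using True a dL \<theta> by linarith
      have "d (Suc j) = d 0 + X (Suc j) - U (Suc j)" using dS XS US IH s a1 by simp
      \<comment> \<open>Right after an override the discrepancy is above \<open>L - 1\<close>, while
        \<open>d 0 \<le> L\<close>; by the identity there are at most \<open>X (Suc j) + 1\<close>
        overrides so far.\<close>
      moreover have "d (Suc j) > L - 1" using dS s True a1 by simp
      ultimately show ?thesis using XC dL jb by auto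
    next
      case False
      then have s: "steered L \<theta> \<alpha> (r + j) = \<alpha> (r + j)"
        using nolow by (simp add: steered_def steer_def d_def)
      show ?thesis using dS XS US IH s a \<theta> by auto
    qed
  qed
  then show ?thesis unfolding U_def by blast
qed

text \<open>The sign of the discrepancy at the start of the window decides which boundary is out of
  reach; a negative start is reflected to a positive one.\<close>

lemma corrections_le:
  assumes \<alpha>: "\<And>k. \<alpha> k \<in> {0, 1}" and \<theta>: "0 \<le> \<theta>" "\<theta> \<le> 1" and L: "real b \<le> L" "1 \<le> L"
    and C: "\<And>m. m \<le> b \<Longrightarrow> \<bar>(\<Sum>i<m. \<alpha> (r + i)) - real m * \<theta>\<bar> \<le> C"
  shows "(\<Sum>i<b. \<bar>steered L \<theta> \<alpha> (r + i) - \<alpha> (r + i)\<bar>) \<le> C + 1"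
proof (cases "0 \<le> disc L \<theta> \<alpha> r")
  case True
  then show ?thesis by (intro corrections_le_aux assms)
next
  case False
  let ?\<alpha> = "\<lambda>i. 1 - \<alpha> i"
  have "(\<Sum>i<b. \<bar>steered L (1 - \<theta>) ?\<alpha> (r + i) - ?\<alpha> (r + i)\<bar>) \<le> C + 1"
  proof (rule corrections_le_aux)
    show "1 - \<alpha> k \<in> {0, 1}" for k using \<alpha>[of k] by auto
    fix m assume "m \<le> b"
    have "(\<Sum>i<m. ?\<alpha> (r + i)) - real m * (1 - \<theta>) = - ((\<Sum>i<m. \<alpha> (r + i)) - real m * \<theta>)"
      by (simp add: sum_subtractf algebra_simps)
    then show "\<bar>(\<Sum>i<m. ?\<alpha> (r + i)) - real m * (1 - \<theta>)\<bar> \<le> C"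
      using C[OF \<open>m \<le> b\<close>] by (simp only: abs_minus_cancel)
  next
    show "0 \<le> disc L (1 - \<theta>) ?\<alpha> r" using False L by (simp add: disc_compl)
  qed (use \<theta> L in auto)
  also have "(\<Sum>i<b. \<bar>steered L (1 - \<theta>) ?\<alpha> (r + i) - ?\<alpha> (r + i)\<bar>)
      = (\<Sum>i<b. \<bar>steered L \<theta> \<alpha> (r + i) - \<alpha> (r + i)\<bar>)"
    using L by (intro sum.cong) (auto simp: steered_compl)
  finally show ?thesis .
qed

section \<open>Atomless coordinates\<close>

text \<open>Without atoms the distribution function is continuous, so all quantiles
  \<open>i / K\<close> are attained; the cells lie between consecutive quantiles.\<close>

lemma (in real_distribution) ex_equipartition_real:
  assumes atomless: "\<And>c. prob {c} = 0" and K: "K > 0"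
  shows "\<exists>J :: real \<Rightarrow> nat. J \<in> measurable borel (count_space UNIV) \<and> (\<forall>x. J x < K) \<and>
    (\<forall>i<K. prob {x. J x = i} = 1 / real K)"
proof -
  have cont: "isCont (cdf M) x" for x
    using isCont_cdf atomless by blast
  have "\<exists>c. cdf M c = p" if p: "0 < p" "p < 1" for p
  proof -
    have "eventually (\<lambda>x. cdf M x < p) at_bot"
      using order_tendstoD(2)[OF cdf_lim_at_bot p(1)] .
    then obtain x1 where x1: "\<And>x. x \<le> x1 \<Longrightarrow> cdf M x < p" unfolding eventually_at_bot_linorder by blast
    have "eventually (\<lambda>x. cdf M x > p) at_top"
      using order_tendstoD(1)[OF cdf_lim_at_top_prob p(2)] .
    then obtain x2 where x2: "\<And>x. x \<ge> x2 \<Longrightarrow> cdf M x > p" unfolding eventually_at_top_linorder by blast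
    have "\<exists>x\<ge>min x1 x2. x \<le> x2 \<and> cdf M x = p"
      by (rule IVT) (use x1[of "min x1 x2"] x2[of x2] cont in auto)
    then show ?thesis by blast
  qed
  then have "\<forall>i\<in>{1..<K}. \<exists>c. cdf M c = real i / real K" by auto
  then obtain c where c: "\<And>i. 1 \<le> i \<Longrightarrow> i < K \<Longrightarrow> cdf M (c i) = real i / real K"
    by (metis atLeastLessThan_iff)
  \<comment> \<open>The right end of cell \<open>i\<close> is \<open>c (Suc i)\<close>; the clause
    \<open>K \<le> Suc i\<close> stops the search at \<open>K - 1\<close>, the unbounded last
    cell.\<close>
  define J where "J x = (LEAST i. K \<le> Suc i \<or> x \<le> c (Suc i))" for x
  have [measurable]: "J \<in> measurable borel (count_space UNIV)"
    unfolding J_def by measurable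
  have JK: "J x \<le> K - 1" for x unfolding J_def by (rule Least_le) auto
  have mono: "c (Suc i) \<le> c (Suc j)" if "i \<le> j" "Suc j < K" for i j
  proof (rule ccontr)
    assume c': "\<not> ?thesis"
    then have "cdf M (c (Suc j)) \<le> cdf M (c (Suc i))" by (intro cdf_nondecreasing) auto
    then have "j \<le> i" using that K by (simp add: c divide_le_cancel)
    with c' that show False by auto
  qed
  have le_iff: "J x \<le> i \<longleftrightarrow> x \<le> c (Suc i)" if "Suc i < K" for i x
  proof
    assume "J x \<le> i"
    have "K \<le> Suc (J x) \<or> x \<le> c (Suc (J x))"
      unfolding J_def by (rule LeastI[of _ "K - 1"]) auto
    then show "x \<le> c (Suc i)" using mono[of "J x" i] \<open>J x \<le> i\<close> that by auto
  qed (auto simp: J_def intro: Least_le)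
  have cum: "prob {x. J x < i} = real i / real K" if iK: "i \<le> K" for i
  proof -
    consider "i = 0" | "i = K" | j where "i = Suc j" "Suc j < K"
      using iK by (cases i; cases "i = K") auto
    then show ?thesis
    proof cases
      case 2
      have "{x. J x < i} = UNIV" using JK K 2 by (auto simp: le_less_trans[OF JK])
      then show ?thesis using prob_space K 2 by simp
    next
      case 3
      have "{x. J x < i} = {..c i}" using le_iff[of j] 3 by (auto simp: less_Suc_eq_le)
      then show ?thesis using c[of i] 3 by (simp add: cdf_def)
    qed simp
  qed
  have "prob {x. J x = i} = 1 / real K" if "i < K" for i
  proof -
    have "{x. J x = i} = {x. J x < Suc i} - {x. J x < i}" by auto
    then have "prob {x. J x = i} = prob {x. J x < Suc i} - prob {x. J x < i}"
      by (simp add: finite_measure_Diff Collect_mono)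
    then show ?thesis using cum[of i] cum[of "Suc i"] that by (simp add: field_simps)
  qed
  moreover have "J x < K" for x using JK[of x] K by auto
  ultimately show ?thesis by (intro exI[of _ J]) auto
qed

lemma (in prob_space) ex_equipartition:
  fixes h :: "'a \<Rightarrow> real"
  assumes h [measurable]: "h \<in> borel_measurable M"
    and atomless: "\<And>c. prob {x \<in> space M. h x = c} = 0" and K: "K > 0"
  shows "\<exists>J :: real \<Rightarrow> nat. J \<in> measurable borel (count_space UNIV) \<and> (\<forall>y. J y < K) \<and>
    (\<forall>i<K. prob {x \<in> space M. J (h x) = i} = 1 / real K)"
proof -
  interpret D: real_distribution "distr M borel h" by (rule real_distribution_distr) auto
  have D: "D.prob A = prob {x \<in> space M. h x \<in> A}" if "A \<in> sets borel" for A
    using that by (subst measure_distr) (auto intro!: arg_cong[where f=prob])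
  obtain J where J [measurable]: "J \<in> measurable borel (count_space UNIV)" and "\<forall>y. J y < K"
    and *: "\<And>i. i < K \<Longrightarrow> D.prob {x. J x = i} = 1 / real K"
    using D.ex_equipartition_real[OF _ K] atomless D by auto
  moreover have "prob {x \<in> space M. J (h x) = i} = 1 / real K" if "i < K" for i
    using *[OF that] by (subst (asm) D) auto
  ultimately show ?thesis by blast
qed

text \<open>The coordinate is the isomorphism onto the model: it is injective off a null set, so its fibres
  are essentially points.\<close>

lemma ex_atomless_coordinate:
  assumes L: "lebesgue_prob_space M" and N: "non_atomic M"
  shows "\<exists>g \<in> borel_measurable M. \<forall>c::real. measure M {x \<in> space M. g x = c} = 0"
proof -
  interpret prob_space M using L by (simp add: lebesgue_prob_space_def)
  obtain N :: "real measure" where sN: "sets N = sets borel" and iso: "isomorphic_mod0 M (completion N)"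
    using L unfolding lebesgue_prob_space_def by (elim conjE exE)
  obtain A B \<phi> where A: "A \<in> null_sets M" and B: "B \<in> null_sets (completion N)"
    and bij: "bij_betw \<phi> (space M - A) (space (completion N) - B)"
    and meas: "\<phi> \<in> measurable (restrict_space M (space M - A))
      (restrict_space (completion N) (space (completion N) - B))"
    using iso unfolding isomorphic_mod0_def by blast
  have [measurable]: "A \<in> sets M" using A by auto
  have spN: "space N = UNIV" using sets_eq_imp_space_eq[OF sN] by simp
  define g where "g x = (if x \<in> space M - A then \<phi> x else 0)" for x
  have "\<phi> \<in> measurable (restrict_space M (space M - A)) (completion N)"
    using meas unfolding measurable_restrict_space2_iff by (rule conjunct1)
  moreover have "(\<lambda>x. x) \<in> measurable (completion N) borel"
    by (rule measurable_completion) (simp add: measurable_cong_sets[OF sN refl])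
  ultimately have \<phi>: "\<phi> \<in> borel_measurable (restrict_space M (space M - A))"
    by (rule measurable_compose)
  have g: "g \<in> borel_measurable M"
    unfolding g_def by (rule measurable_restrict_space_iff[THEN iffD1, OF _ _ \<phi>]) auto
  have "measure M {x \<in> space M. g x = c} = 0" for c
  proof -
    define P where "P = {x \<in> space M. x \<notin> A \<and> g x = c}"
    have [measurable]: "P \<in> sets M"
      using g unfolding P_def by measurable
    have one: "x = y" if "x \<in> P" "y \<in> P" for x y
      using that bij unfolding P_def g_def bij_betw_def inj_on_def by auto
    have "emeasure M P = 0"
    proof (rule ccontr)
      assume "emeasure M P \<noteq> 0"
      then have "emeasure M P > 0" by (simp add: zero_less_iff_neq_zero)
      moreover have "emeasure M Q = 0 \<or> emeasure M (P - Q) = 0" if "Q \<subseteq> P" for Q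
      proof -
        have "Q = {} \<or> P - Q = {}" using that one by blast
        then show ?thesis by (metis emeasure_empty)
      qed
      ultimately show False using N \<open>P \<in> sets M\<close> unfolding non_atomic_def by blast
    qed
    then have "P \<in> null_sets M" by (simp add: null_sets_def)
    then have "P \<union> A \<in> null_sets M" using A by (rule null_sets.Un)
    moreover have "measure M {x \<in> space M. g x = c} \<le> measure M (P \<union> A)"
      by (rule finite_measure_mono) (auto simp only: P_def[symmetric] sets.Un \<open>P \<in> sets M\<close> \<open>A \<in> sets M\<close>, auto simp: P_def)
    ultimately show ?thesis by (simp add: measure_eq_0_null_sets measure_le_0_iff)
  qed
  with g show ?thesis by blast
qed

section \<open>Towers over a small set\<close>

locale invertible_ergodic = ergodic_mpt +
  fixes T' :: "'a \<Rightarrow> 'a"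
  assumes T'_meas [measurable]: "T' \<in> measurable M M"
    and T'_T [simp]: "x \<in> space M \<Longrightarrow> T' (T x) = x"
    and T_T' [simp]: "x \<in> space M \<Longrightarrow> T (T' x) = x"
begin

lemma T'_pres: "distr M M T' = M"
proof -
  have "distr M M T' = distr (distr M M T) M T'" by (simp add: T_pres)
  also have "\<dots> = distr M M (T' \<circ> T)" by (rule distr_distr) auto
  also have "\<dots> = distr M M (\<lambda>x. x)" by (rule distr_cong) auto
  finally show ?thesis by simp
qed

sublocale inv: mpt M T'
  by unfold_locales (auto simp: T'_pres)

lemma funpow_inverse: "x \<in> space M \<Longrightarrow> (T ^^ k) ((T' ^^ k) x) = x"
proof (induction k arbitrary: x)
  case (Suc k)
  have "(T ^^ Suc k) ((T' ^^ Suc k) x) = (T ^^ k) (T (T' ((T' ^^ k) x)))"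
    by (simp add: funpow_swap1)
  also have "\<dots> = x" using Suc by simp
  finally show ?case .
qed simp

lemma inv_funpow_Suc_T: "x \<in> space M \<Longrightarrow> (T' ^^ Suc k) (T x) = (T' ^^ k) x"
  by (simp add: funpow_Suc_right del: funpow.simps)

text \<open>Hitting \<open>E\<close> at arbitrarily large backward times is an invariant event. It
  is a decreasing intersection of events of probability at least \<open>prob E\<close>, so by
  ergodicity it has full measure.\<close>

lemma AE_hits:
  assumes E [measurable]: "E \<in> sets M" and pos: "prob E > 0"
  shows "AE x in M. \<exists>k. (T' ^^ k) x \<in> E"
proof -
  define Z where "Z n = {x \<in> space M. \<exists>k\<ge>n. (T' ^^ k) x \<in> E}" for n
  have [measurable]: "Z n \<in> sets M" for n unfolding Z_def by measurable
  have step: "T x \<in> Z (Suc n) \<longleftrightarrow> x \<in> Z n" if "x \<in> space M" for x n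
  proof -
    have "(\<exists>k\<ge>Suc n. (T' ^^ k) (T x) \<in> E) \<longleftrightarrow> (\<exists>k\<ge>n. (T' ^^ Suc k) (T x) \<in> E)"
      by (metis Suc_le_D Suc_le_mono)
    then show ?thesis using that by (simp add: Z_def inv_funpow_Suc_T del: funpow.simps)
  qed
  have dec: "decseq Z" unfolding decseq_def Z_def by (auto intro: order_trans)
  have "T -` (\<Inter>n. Z n) \<inter> space M = (\<Inter>n. Z n)"
  proof (rule set_eqI)
    fix x
    show "x \<in> T -` (\<Inter>n. Z n) \<inter> space M \<longleftrightarrow> x \<in> (\<Inter>n. Z n)"
    proof (cases "x \<in> space M")
      case True
      have "Z (Suc n) \<subseteq> Z n" for n using decseq_SucD[OF dec] .
      then have "(\<forall>n. T x \<in> Z n) \<longleftrightarrow> (\<forall>n. T x \<in> Z (Suc n))" by blast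
      then show ?thesis using step[OF True] True by simp
    qed (auto simp: Z_def)
  qed
  then have "prob (\<Inter>n. Z n) = 0 \<or> prob (\<Inter>n. Z n) = 1" by (intro erg) auto
  moreover have "(\<lambda>n. prob (Z n)) \<longlonglongrightarrow> prob (\<Inter>n. Z n)"
    using dec by (intro finite_Lim_measure_decseq) auto
  then have "prob E \<le> prob (\<Inter>n. Z n)"
  proof (rule LIMSEQ_le_const)
    have "prob E = prob {x \<in> space M. (T' ^^ n) x \<in> E}" for n
      by (rule inv.prob_funpow[symmetric]) fact
    also have "\<dots> n \<le> prob (Z n)" for n
      by (rule finite_measure_mono) (auto simp: Z_def)
    finally show "\<exists>N. \<forall>n\<ge>N. prob E \<le> prob (Z n)" by blast
  qed
  ultimately have "prob (\<Inter>n. Z n) = 1" using pos by auto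
  then have "AE x in M. x \<in> (\<Inter>n. Z n)" by (simp add: prob_eq_1)
  then show ?thesis by eventually_elim (auto simp: Z_def)
qed

end

lemma (in prob_space) ex_small_event:
  fixes g :: "'a \<Rightarrow> real"
  assumes g [measurable]: "g \<in> borel_measurable M"
    and atomless: "\<And>c. prob {x \<in> space M. g x = c} = 0" and "\<delta> > 0"
  shows "\<exists>E \<in> sets M. 0 < prob E \<and> prob E < \<delta>"
proof -
  obtain K :: nat where K: "K > 0" "1 / real K < \<delta>"
    using \<open>\<delta> > 0\<close> by (metis inverse_eq_divide ex_inverse_of_nat_less)
  obtain J :: "real \<Rightarrow> nat" where [measurable]: "J \<in> measurable borel (count_space UNIV)"
    and J: "\<forall>i<K. prob {x \<in> space M. J (g x) = i} = 1 / real K"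
    using ex_equipartition[OF g atomless K(1)] by blast
  show ?thesis
    by (rule bexI[of _ "{x \<in> space M. J (g x) = 0}"]) (use J K in auto)
qed

lemma disc_measurable [measurable (raw)]:
  assumes [measurable]: "\<theta> \<in> borel_measurable M" "\<And>i. (\<lambda>x. \<alpha> x i) \<in> borel_measurable M"
  shows "(\<lambda>x. disc L (\<theta> x) (\<alpha> x) k) \<in> borel_measurable M"
proof (induction k)
  case (Suc k)
  note [measurable] = Suc
  show ?case unfolding disc.simps steer_def by measurable
qed simp

lemma steered_measurable [measurable (raw)]:
  assumes [measurable]: "\<theta> \<in> borel_measurable M" "\<And>i. (\<lambda>x. \<alpha> x i) \<in> borel_measurable M"
  shows "(\<lambda>x. steered L (\<theta> x) (\<alpha> x) k) \<in> borel_measurable M"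
  unfolding steered_def steer_def by measurable

context invertible_ergodic
begin

text \<open>The height of \<open>x\<close> in the tower over \<open>E\<close>, which is 0 on
  \<open>E\<close> itself. It is unspecified where the backward orbit misses \<open>E\<close>, a
  null set by \<open>AE_hits\<close> when \<open>E\<close> has positive measure.\<close>

definition hit :: "'a set \<Rightarrow> 'a \<Rightarrow> nat" where
  "hit E x = (LEAST k. (T' ^^ k) x \<in> E)"

definition base :: "'a set \<Rightarrow> 'a \<Rightarrow> 'a" where
  "base E x = (T' ^^ hit E x) x"

lemma hit_measurable [measurable]:
  assumes [measurable]: "E \<in> sets M"
  shows "hit E \<in> measurable M (count_space UNIV)"
  unfolding hit_def[abs_def] by measurable

lemma base_measurable [measurable]:
  assumes [measurable]: "E \<in> sets M"
  shows "base E \<in> measurable M M"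
  unfolding base_def[abs_def] by (rule measurable_compose_countable) measurable

lemma hit_base_T:
  assumes x: "x \<in> space M" and h: "\<exists>k. (T' ^^ k) x \<in> E" and "T x \<notin> E"
  shows "hit E (T x) = Suc (hit E x)" "base E (T x) = base E x"
proof -
  obtain k where "(T' ^^ k) x \<in> E" using h by blast
  then have "(T' ^^ Suc k) (T x) \<in> E" using x by (simp only: inv_funpow_Suc_T)
  then have "hit E (T x) = Suc (LEAST k. (T' ^^ Suc k) (T x) \<in> E)"
    unfolding hit_def by (rule Least_Suc) (use \<open>T x \<notin> E\<close> in simp)
  then show hit: "hit E (T x) = Suc (hit E x)"
    unfolding hit_def inv_funpow_Suc_T[OF x] .
  show "base E (T x) = base E x"
    unfolding base_def hit inv_funpow_Suc_T[OF x] ..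
qed

text \<open>Until its next visit to \<open>E\<close> the orbit climbs above one base point, so
  anything computed from the base point is shared by the whole piece.\<close>

lemma hit_base_funpow:
  assumes x: "x \<in> space M" and h: "\<exists>k. (T' ^^ k) x \<in> E" and "\<And>i. 1 \<le> i \<Longrightarrow> i \<le> m \<Longrightarrow> (T ^^ i) x \<notin> E"
  shows "hit E ((T ^^ m) x) = hit E x + m \<and> base E ((T ^^ m) x) = base E x
    \<and> (\<exists>k. (T' ^^ k) ((T ^^ m) x) \<in> E)"
  using assms(3)
proof (induction m)
  case 0
  then show ?case using h by simp
next
  case (Suc m)
  then have IH: "hit E ((T ^^ m) x) = hit E x + m" "base E ((T ^^ m) x) = base E x"
    "\<exists>k. (T' ^^ k) ((T ^^ m) x) \<in> E" by auto
  have sp: "(T ^^ m) x \<in> space M" using x by simp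
  have "T ((T ^^ m) x) \<notin> E" using Suc.prems[of "Suc m"] by simp
  note * = hit_base_T[OF sp IH(3) this]
  obtain k where "(T' ^^ k) ((T ^^ m) x) \<in> E" using IH(3) by blast
  then have "(T' ^^ Suc k) (T ((T ^^ m) x)) \<in> E" using sp by (simp only: inv_funpow_Suc_T)
  then have "\<exists>k. (T' ^^ k) (T ((T ^^ m) x)) \<in> E" by (rule exI)
  then have "\<exists>k. (T' ^^ k) ((T ^^ Suc m) x) \<in> E" by simp
  then show ?case using * IH by simp
qed

lemma prob_visits_le:
  assumes [measurable]: "E \<in> sets M"
  shows "prob {x \<in> space M. \<exists>i\<in>{1..m}. (T ^^ i) x \<in> E} \<le> real m * prob E"
proof -
  have "{x \<in> space M. \<exists>i\<in>{1..m}. (T ^^ i) x \<in> E} = (\<Union>i\<in>{1..m}. {x \<in> space M. (T ^^ i) x \<in> E})"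
    by auto
  also have "prob \<dots> \<le> (\<Sum>i\<in>{1..m}. prob {x \<in> space M. (T ^^ i) x \<in> E})"
    by (rule finite_measure_subadditive_finite) auto
  also have "\<dots> = real m * prob E" by (simp add: prob_funpow)
  finally show ?thesis .
qed

text \<open>The perturbation step behind density: the bits of \<open>A\<close> are steered with a
  slope that depends on the base point. The parameters are chosen in the order \<eta>,
  \<open>b\<close>, \<open>n\<close>, \<open>E\<close>, each depending on the previous ones.\<close>

lemma ex_steered_set:
  fixes g :: "'a \<Rightarrow> real" and l :: "real list"
  assumes g [measurable]: "g \<in> borel_measurable M" and atomless: "\<And>c. prob {x \<in> space M. g x = c} = 0"
    and a: "filterlim a at_top sequentially" "(\<lambda>n. a n / real n) \<longlonglongrightarrow> 0"
    and l: "l \<noteq> []" "sum_list l = 0"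
    and A [measurable]: "A \<in> sets M" and e: "e > 0" and \<epsilon>: "\<epsilon> > 0"
  shows "\<exists>B \<in> sets M. prob (sym_diff A B) < e \<and> (\<exists>n>m. a n > 0 \<and> (\<exists>Y \<in> borel_measurable M.
    (\<forall>y. prob {x \<in> space M. Y x \<le> y} = real (card {i. i < length l \<and> l ! i \<le> y}) / real (length l)) \<and>
    prob {x \<in> space M. \<bar>1 / a n * birkhoff_sum T (\<lambda>y. indicator B y - prob B) n x - Y x\<bar> > \<epsilon>} < \<epsilon>))"
proof -
  define K where "K = length l"
  define R where "R = (\<Sum>i<K. \<bar>l ! i\<bar>)"
  have K: "K > 0" using l by (simp add: K_def)
  have Ml: "\<bar>l ! i\<bar> \<le> R" if "i < K" for i
    unfolding R_def using that by (intro member_le_sum) auto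
  have Ml0: "0 \<le> R" unfolding R_def by (intro sum_nonneg) auto
  \<comment> \<open>The factor 6 pays for \<open>3 * \<eta>\<close> of drift, \<eta> for the
    additive 1 in \<open>corrections_le\<close>, and \<eta> for each of two exceptional sets. The
    bound 1/4 keeps \<open>[\<eta>, 1 - \<eta>]\<close> nonempty.\<close>
  define \<eta> where "\<eta> = min (e / 6) (1 / 4)"
  have \<eta>: "0 < \<eta>" "6 * \<eta> \<le> e" "\<eta> \<le> 1 / 4" unfolding \<eta>_def using e by auto
  \<comment> \<open>Clamping \<open>prob A\<close> leaves a margin \<eta> at both ends, so that
    slopes within \<eta> of \<open>c\<close> stay in \<open>[0, 1]\<close>.\<close>
  define c where "c = max \<eta> (min (1 - \<eta>) (prob A))"
  have c: "\<eta> \<le> c" "c \<le> 1 - \<eta>" "\<bar>c - prob A\<bar> \<le> \<eta>"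
  proof -
    have "\<eta> \<le> max \<eta> (min (1 - \<eta>) p) \<and> max \<eta> (min (1 - \<eta>) p) \<le> 1 - \<eta> \<and>
      \<bar>max \<eta> (min (1 - \<eta>) p) - p\<bar> \<le> \<eta>" if "0 \<le> p" "p \<le> 1" for p
      using that \<eta> by (auto simp: max_def min_def)
    from this[of "prob A"] show "\<eta> \<le> c" "c \<le> 1 - \<eta>" "\<bar>c - prob A\<bar> \<le> \<eta>"
      unfolding c_def by auto
  qed

  \<comment> \<open>Window length from the ergodic theorem, and the time \<open>n\<close>\<close>
  obtain b0 where b0: "\<And>b. b \<ge> b0 \<Longrightarrow> prob {x \<in> space M. \<exists>k\<le>b. \<bar>birkhoff_sum T (indicator A) k x
    - real k * prob A\<bar> > \<eta> * real b} < \<eta>"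
    using birkhoff_sum_uniform_close[OF A \<eta>(1)] by blast
  obtain b1 :: nat where b1: "real b1 * \<eta> > 1" using reals_Archimedean3[OF \<eta>(1)] by blast
  define b where "b = max b0 b1"
  have b: "real b * \<eta> > 1" "b \<ge> b0"
    using b1 \<eta> by (auto simp: b_def intro: less_le_trans[OF b1] mult_right_mono)
  have b_pos: "b > 0" using b(1) by (cases b) auto
  \<comment> \<open>The half-width of the strip equals the window length, as the count of
    corrections requires.\<close>
  define L where "L = real b"
  have L: "1 \<le> L" "real b \<le> L" unfolding L_def using b_pos by auto
  define W where "W = {x \<in> space M. \<exists>k\<le>b. \<bar>birkhoff_sum T (indicator A) k x - real k * prob A\<bar> > \<eta> * real b}"
  have [measurable]: "W \<in> sets M" unfolding W_def by measurable
  have W: "prob W < \<eta>" unfolding W_def by (rule b0) (rule b(2))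

  \<comment> \<open>Large \<open>a n\<close> makes an error of \<open>4 * L\<close> at most half of
    \<open>\<epsilon> * a n\<close>; small \<open>a n / n\<close> keeps all slopes within \<eta> of
    \<open>c\<close>.\<close>
  have "eventually (\<lambda>n. n > m \<and> a n > max 0 (8 * L / \<epsilon>) \<and> a n / real n < \<eta> / (R + 1)) sequentially"
    using eventually_gt_at_top[of m] a(1)[unfolded filterlim_at_top_dense, rule_format, of "max 0 (8 * L / \<epsilon>)"]
      order_tendstoD(2)[OF a(2), of "\<eta> / (R + 1)"] \<eta>(1) Ml0
    by (auto elim: eventually_elim2 intro!: eventually_conj)
  then obtain n where n: "n > m" "a n > 0" "a n > 8 * L / \<epsilon>" "a n / real n < \<eta> / (R + 1)"
    by (auto simp: eventually_sequentially)
  have n_pos: "real n > 0" using n(1) by simp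

  \<comment> \<open>Base of the tower and the target variable\<close>
  obtain E where E [measurable]: "E \<in> sets M" and E_pos: "0 < prob E"
    and E_small: "prob E < min (\<epsilon> / real n) (min (\<epsilon> * a n / (2 * real n * real n)) (\<eta> / real b))"
    using ex_small_event[OF g atomless, of "min (\<epsilon> / real n) (min (\<epsilon> * a n / (2 * real n * real n)) (\<eta> / real b))"]
      \<epsilon> \<eta> n n_pos b_pos by auto
  \<comment> \<open>In this order: visits to \<open>E\<close> during \<open>n\<close> steps, their
    effect on the mean of the sum, and visits during a window of \<open>b\<close> steps.\<close>
  have E1: "real n * prob E < \<epsilon>" and E2: "real n * (real n * prob E) < \<epsilon> * a n / 2" and E3: "real b * prob E < \<eta>"
    using E_small n_pos b_pos by (auto simp: field_simps)
  define bad where "bad j = {x \<in> space M. \<exists>i\<in>{1..j}. (T ^^ i) x \<in> E}" for j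
  have [measurable]: "bad j \<in> sets M" for j unfolding bad_def by measurable
  have bad: "prob (bad j) \<le> real j * prob E" for j
    unfolding bad_def by (rule prob_visits_le) fact

  \<comment> \<open>\<open>base E x\<close> is one of countably many backward iterates of
    \<open>x\<close>, each of which preserves the measure, so the fibres of \<open>g\<close> stay
    null.\<close>
  have base_atomless: "prob {x \<in> space M. g (base E x) = c} = 0" for c
  proof -
    have "prob (\<Union>k. {x \<in> space M. g ((T' ^^ k) x) = c}) = 0"
    proof -
      have "{x \<in> space M. g ((T' ^^ k) x) = c} \<in> null_sets M" for k
      proof -
        have "{x \<in> space M. g ((T' ^^ k) x) = c} = {x \<in> space M. (T' ^^ k) x \<in> {x \<in> space M. g x = c}}"
          by auto
        then have "prob {x \<in> space M. g ((T' ^^ k) x) = c} = 0"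
          using inv.prob_funpow[of "{x \<in> space M. g x = c}" k] atomless by simp
        then show ?thesis by (simp add: null_sets_def emeasure_eq_measure)
      qed
      then have "(\<Union>k. {x \<in> space M. g ((T' ^^ k) x) = c}) \<in> null_sets M" by blast
      then show ?thesis by (rule measure_eq_0_null_sets)
    qed
    moreover have "prob {x \<in> space M. g (base E x) = c} \<le> prob (\<Union>k. {x \<in> space M. g ((T' ^^ k) x) = c})"
      by (rule finite_measure_mono) (auto simp: base_def)
    ultimately show ?thesis by (metis measure_nonneg order_antisym)
  qed
  obtain J :: "real \<Rightarrow> nat" where [measurable]: "J \<in> measurable borel (count_space UNIV)"
    and JK: "\<And>y. J y < K"
    and J: "\<And>i. i < K \<Longrightarrow> prob {x \<in> space M. J (g (base E x)) = i} = 1 / real K"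
    using ex_equipartition[OF _ base_atomless K] by auto
  \<comment> \<open>A uniformly distributed position of \<open>l\<close>, chosen as a function of
    the base point, so that \<open>Y\<close> is constant on orbit pieces between visits to
    \<open>E\<close>.\<close>
  define Y where "Y x = l ! J (g (base E x))" for x
  have Y_meas [measurable]: "Y \<in> borel_measurable M" unfolding Y_def[abs_def] by measurable
  have Y_le: "\<bar>Y x\<bar> \<le> R" for x unfolding Y_def using Ml JK by blast
  have Y_law: "prob {x \<in> space M. Y x \<le> y} = real (card {i. i < length l \<and> l ! i \<le> y}) / real (length l)" for y
  proof -
    have "{x \<in> space M. Y x \<le> y} = (\<Union>i\<in>{i. i < K \<and> l ! i \<le> y}. {x \<in> space M. J (g (base E x)) = i})"
      unfolding Y_def using JK by auto
    also have "prob \<dots> = (\<Sum>i\<in>{i. i < K \<and> l ! i \<le> y}. prob {x \<in> space M. J (g (base E x)) = i})"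
      by (rule finite_measure_finite_Union) (auto simp: disjoint_family_on_def)
    also have "\<dots> = real (card {i. i < K \<and> l ! i \<le> y}) / real K" by (simp add: J)
    finally show ?thesis unfolding K_def .
  qed
  have Y_mean: "(\<integral>x. Y x \<partial>M) = 0"
  proof -
    have "Y x = (\<Sum>i<K. l ! i * indicator {x \<in> space M. J (g (base E x)) = i} x)" if "x \<in> space M" for x
    proof -
      have "(\<Sum>i<K. l ! i * indicator {x \<in> space M. J (g (base E x)) = i} x)
          = (\<Sum>i<K. if J (g (base E x)) = i then l ! i else 0)"
        using that by (intro sum.cong) auto
      then show ?thesis using JK by (simp add: Y_def)
    qed
    then have "(\<integral>x. Y x \<partial>M) = (\<integral>x. (\<Sum>i<K. l ! i * indicator {x \<in> space M. J (g (base E x)) = i} x) \<partial>M)"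
      by (intro Bochner_Integration.integral_cong) auto
    also have "\<dots> = (\<Sum>i<K. l ! i * (1 / real K))"
      by (subst Bochner_Integration.integral_sum) (auto simp: J emeasure_eq_measure)
    also have "\<dots> = sum_list l / real K"
      by (simp add: sum_list_sum_nth K_def atLeast0LessThan sum_divide_distrib)
    finally show ?thesis using l by simp
  qed

  \<comment> \<open>The steered set\<close>
  define \<theta> where "\<theta> x = c + a n / real n * Y x" for x
  have \<theta>_c: "\<bar>\<theta> x - c\<bar> \<le> \<eta>" for x
  proof -
    have "\<bar>\<theta> x - c\<bar> = a n / real n * \<bar>Y x\<bar>" unfolding \<theta>_def using n n_pos by (simp add: abs_mult)
    also have "\<dots> \<le> \<eta> / (R + 1) * (R + 1)"
      using n n_pos Y_le[of x] Ml0 \<eta> by (intro mult_mono) auto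
    finally show ?thesis using Ml0 by simp
  qed
  have \<theta>01: "0 \<le> \<theta> x" "\<theta> x \<le> 1" for x using \<theta>_c[of x] c \<eta> unfolding abs_le_iff by linarith+
  \<comment> \<open>The reason for the factor \<open>a n / n\<close> in the slope: over
    \<open>n\<close> steps the deviation from \<open>n * c\<close> is exactly
    \<open>a n * Y\<close>.\<close>
  have n\<theta>: "real n * \<theta> x = real n * c + a n * Y x" for x
    using n_pos by (simp add: \<theta>_def field_simps)
  have [measurable]: "\<theta> \<in> borel_measurable M" unfolding \<theta>_def[abs_def] by measurable
  \<comment> \<open>The bits of \<open>A\<close> read upwards from the base point, hence the same
    sequence at every height of a piece; \<beta> below picks the steered bit at the height of
    \<open>x\<close>.\<close>
  define \<alpha> where "\<alpha> x k = (indicator A ((T ^^ k) (base E x)) :: real)" for x k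
  have \<alpha>01: "\<alpha> x k \<in> {0, 1}" for x k by (auto simp: \<alpha>_def indicator_def)
  have [measurable]: "(\<lambda>x. \<alpha> x k) \<in> borel_measurable M" for k unfolding \<alpha>_def by measurable
  define \<beta> where "\<beta> x = steered L (\<theta> x) (\<alpha> x) (hit E x)" for x
  have [measurable]: "\<beta> \<in> borel_measurable M"
    unfolding \<beta>_def[abs_def] by (rule measurable_compose_countable) measurable
  define B where "B = {x \<in> space M. \<beta> x = 1}"
  have B [measurable]: "B \<in> sets M" unfolding B_def by measurable
  have ind_B: "indicator B x = \<beta> x" if "x \<in> space M" for x
    using steered_01[where \<alpha>="\<alpha> x" and k="hit E x" and L=L and \<theta>="\<theta> x", OF \<alpha>01] that
    by (auto simp: B_def \<beta>_def indicator_def)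

  \<comment> \<open>Without visits to \<open>E\<close> at times 1 to \<open>j\<close>, the points of
    the orbit segment share base, slope and bit sequence, so they read consecutive entries of one
    steered sequence, starting at height \<open>hit E x\<close>.\<close>
  have window: "indicator B ((T ^^ i) x) = steered L (\<theta> x) (\<alpha> x) (hit E x + i)
      \<and> indicator A ((T ^^ i) x) = \<alpha> x (hit E x + i)"
    if x: "x \<in> space M" "\<exists>k. (T' ^^ k) x \<in> E" "x \<notin> bad j" and "i < j" for x i j
  proof -
    have hb: "hit E ((T ^^ i) x) = hit E x + i" "base E ((T ^^ i) x) = base E x"
      using hit_base_funpow[of x E i] x \<open>i < j\<close> by (auto simp: bad_def)
    then have "\<theta> ((T ^^ i) x) = \<theta> x" "\<alpha> ((T ^^ i) x) = \<alpha> x"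
      by (auto simp: \<theta>_def Y_def \<alpha>_def fun_eq_iff)
    then have "\<beta> ((T ^^ i) x) = steered L (\<theta> x) (\<alpha> x) (hit E x + i)"
      unfolding \<beta>_def hb by simp
    moreover have "(T ^^ (hit E x + i)) (base E x) = (T ^^ i) x"
      unfolding base_def add.commute[of "hit E x"] funpow_add comp_def using x by (simp add: funpow_inverse)
    ultimately show ?thesis using ind_B x by (simp add: \<alpha>_def)
  qed

  \<comment> \<open>Mean and law of the normalized sum\<close>
  define S where "S x = birkhoff_sum T (indicator B) n x" for x
  have [measurable]: "S \<in> borel_measurable M" unfolding S_def[abs_def] by measurable
  have S_n: "0 \<le> S x" "S x \<le> real n" for x
    unfolding S_def birkhoff_sum_def
    using sum_bounded_above[of "{..<n}" "\<lambda>i. indicator B ((T ^^ i) x)" "1::real"]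
    by (auto intro!: sum_nonneg)
  have hits: "AE x in M. \<exists>k. (T' ^^ k) x \<in> E" by (rule AE_hits) (use E_pos in auto)
  have good: "\<bar>S x - real n * \<theta> x\<bar> \<le> 2 * L"
    if "x \<in> space M" "\<exists>k. (T' ^^ k) x \<in> E" "x \<notin> bad n" for x
  proof -
    have "S x = (\<Sum>i<n. steered L (\<theta> x) (\<alpha> x) (hit E x + i))"
      unfolding S_def birkhoff_sum_def using window[OF that] by (intro sum.cong) auto
    then show ?thesis
      using abs_disc_le[where \<alpha>="\<alpha> x" and \<theta>="\<theta> x" and L=L and k="hit E x", OF \<alpha>01 \<theta>01 L(1)]
        abs_disc_le[where \<alpha>="\<alpha> x" and \<theta>="\<theta> x" and L=L and k="hit E x + n", OF \<alpha>01 \<theta>01 L(1)]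
      unfolding sum_steered by linarith
  qed

  \<comment> \<open>As \<open>Y\<close> is centred, \<theta> has mean \<open>c\<close>. Almost
    everywhere off \<open>bad n\<close> the sum is within \<open>2 * L\<close> of
    \<open>n * \<theta>\<close>; on \<open>bad n\<close> both lie between 0 and
    \<open>n\<close>.\<close>
  have mean: "\<bar>real n * prob B - real n * c\<bar> \<le> 2 * L + real n * (real n * prob E)"
  proof -
    have int: "integrable M S" "integrable M Y"
      by (rule integrable_const_bound[where B="real n"], use S_n in auto)
        (rule integrable_const_bound[where B="R"], use Y_le in auto)
    have "(\<integral>x. S x \<partial>M) = real n * prob B"
      unfolding S_def using integral_birkhoff_sum[of "indicator B" 1 n] by simp
    then have "real n * prob B - real n * c = (\<integral>x. S x - real n * \<theta> x \<partial>M)"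
      unfolding n\<theta> using int Y_mean by (simp add: prob_space)
    also have "\<bar>\<dots>\<bar> \<le> (\<integral>x. \<bar>S x - real n * \<theta> x\<bar> \<partial>M)" by (rule integral_abs_bound)
    also have "\<dots> \<le> (\<integral>x. 2 * L + real n * indicator (bad n) x \<partial>M)"
    proof (rule integral_mono_AE)
      show "integrable M (\<lambda>x. \<bar>S x - real n * \<theta> x\<bar>)" unfolding n\<theta> using int by auto
      show "AE x in M. \<bar>S x - real n * \<theta> x\<bar> \<le> 2 * L + real n * indicator (bad n) x"
        using hits AE_space
      proof eventually_elim
        case (elim x)
        have "\<bar>S x - real n * \<theta> x\<bar> \<le> real n"
          using S_n[of x] mult_left_mono[OF \<theta>01(2) of_nat_0_le_iff, of n x]
            mult_nonneg_nonneg[OF of_nat_0_le_iff \<theta>01(1), of n x] unfolding abs_le_iff by linarith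
        then show ?case using good[of x] elim L by (auto simp: indicator_def)
      qed
    qed (auto intro!: integrable_real_mult_indicator simp: emeasure_eq_measure)
    also have "\<dots> = 2 * L + real n * prob (bad n)"
      by (simp add: prob_space emeasure_eq_measure)
    also have "\<dots> \<le> 2 * L + real n * (real n * prob E)"
      using bad[of n] by (simp add: mult_left_mono)
    finally show ?thesis .
  qed

  have "prob {x \<in> space M. \<bar>1 / a n * birkhoff_sum T (\<lambda>y. indicator B y - prob B) n x - Y x\<bar> > \<epsilon>} \<le> prob (bad n)"
  proof (rule finite_measure_mono_AE)
    show "AE x in M. x \<in> {x \<in> space M. \<bar>1 / a n * birkhoff_sum T (\<lambda>y. indicator B y - prob B) n x - Y x\<bar> > \<epsilon>} \<longrightarrow> x \<in> bad n"
      using hits AE_space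
    proof eventually_elim
      case (elim x)
      have "\<bar>1 / a n * birkhoff_sum T (\<lambda>y. indicator B y - prob B) n x - Y x\<bar> \<le> \<epsilon>" if "x \<notin> bad n"
      proof -
        \<comment> \<open>One \<open>2 * L\<close> comes from the sum, the other from replacing
          \<open>n * c\<close> by the true centring \<open>n * prob B\<close>.\<close>
        have "\<bar>S x - real n * prob B - a n * Y x\<bar> \<le> 4 * L + real n * (real n * prob E)"
          using good[OF elim(2,1) that] mean unfolding n\<theta> by linarith
        also have "\<dots> \<le> \<epsilon> * a n"
          using E2 n(3) \<epsilon> by (simp add: field_simps)
        finally have "\<bar>S x - real n * prob B - a n * Y x\<bar> / a n \<le> \<epsilon>"
          using n(2) by (simp add: divide_le_eq)
        moreover have "1 / a n * birkhoff_sum T (\<lambda>y. indicator B y - prob B) n x - Y x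
            = (S x - real n * prob B - a n * Y x) / a n"
          using n(2) by (simp add: birkhoff_sum_diff_const S_def field_simps)
        ultimately show ?thesis using n(2) by (simp add: abs_divide)
      qed
      then show ?case by force
    qed
  qed measurable
  then have close: "prob {x \<in> space M. \<bar>1 / a n * birkhoff_sum T (\<lambda>y. indicator B y - prob B) n x - Y x\<bar> > \<epsilon>} < \<epsilon>"
    using bad[of n] E1 by linarith

  \<comment> \<open>Distance from the original set\<close>
  define f where "f x = \<bar>indicator B x - indicator A x :: real\<bar>" for x
  have [measurable]: "f \<in> borel_measurable M" unfolding f_def[abs_def] by measurable
  have f01: "0 \<le> f x" "f x \<le> 1" for x unfolding f_def by (auto simp: indicator_def)
  \<comment> \<open>By invariance, the expected number of flips in a window is \<open>b\<close>
    times the measure of the symmetric difference.\<close>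
  have "real b * prob (sym_diff A B) = (\<integral>x. birkhoff_sum T f b x \<partial>M)"
  proof -
    have "f x = indicator (sym_diff A B) x" for x unfolding f_def by (auto simp: indicator_def)
    then have "(\<integral>x. f x \<partial>M) = prob (sym_diff A B)" by simp
    then show ?thesis by (subst integral_birkhoff_sum[where C=1]) (use f01 in auto)
  qed
  \<comment> \<open>Off \<open>bad b\<close> and \<open>W\<close> the count of corrections applies;
    on these small sets all \<open>b\<close> bits may be flipped.\<close>
  also have "\<dots> \<le> (\<integral>x. (3 * \<eta> * real b + 1) + real b * indicator (bad b) x + real b * indicator W x \<partial>M)"
  proof (rule integral_mono_AE)
    have fb: "0 \<le> birkhoff_sum T f b x \<and> birkhoff_sum T f b x \<le> real b" for x
      unfolding birkhoff_sum_def using f01 sum_bounded_above[of "{..<b}" "\<lambda>i. f ((T ^^ i) x)" 1]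
      by (auto intro!: sum_nonneg)
    then show "integrable M (birkhoff_sum T f b)"
      by (intro integrable_const_bound[where B="real b"]) auto
    show "AE x in M. birkhoff_sum T f b x \<le> (3 * \<eta> * real b + 1) + real b * indicator (bad b) x + real b * indicator W x"
      using hits AE_space
    proof eventually_elim
      case (elim x)
      show ?case
      proof (cases "x \<in> bad b \<or> x \<in> W")
        case True
        have "0 \<le> 3 * \<eta> * real b + 1" using \<eta> by simp
        then show ?thesis using fb[of x] True by (auto simp: indicator_def)
      next
        case False
        note w = window[OF elim(2,1)]
        have "birkhoff_sum T f b x = (\<Sum>i<b. \<bar>steered L (\<theta> x) (\<alpha> x) (hit E x + i) - \<alpha> x (hit E x + i)\<bar>)"
          unfolding birkhoff_sum_def f_def using w False by (intro sum.cong) auto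
        also have "\<dots> \<le> 3 * \<eta> * real b + 1"
        proof (rule corrections_le[OF \<alpha>01 \<theta>01 L(2,1)])
          fix k assume k: "k \<le> b"
          have "(\<Sum>i<k. \<alpha> x (hit E x + i)) = birkhoff_sum T (indicator A) k x"
            unfolding birkhoff_sum_def using w[of b] False k by (intro sum.cong) auto
          moreover have "\<bar>birkhoff_sum T (indicator A) k x - real k * prob A\<bar> \<le> \<eta> * real b"
            using False elim k by (auto simp: W_def not_less)
          \<comment> \<open>Both \<open>prob A\<close> and \<theta> are within \<eta> of
            \<open>c\<close>; the ergodic estimate contributes the third \<eta>.\<close>
          moreover have "\<bar>real k * prob A - real k * \<theta> x\<bar> \<le> real b * (2 * \<eta>)"
          proof -
            have "\<bar>real k * prob A - real k * \<theta> x\<bar> = real k * \<bar>prob A - \<theta> x\<bar>"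
              by (simp add: abs_mult right_diff_distrib[symmetric])
            also have "\<dots> \<le> real b * (2 * \<eta>)"
              using k c(3) \<theta>_c[of x] by (intro mult_mono) auto
            finally show ?thesis .
          qed
          ultimately show "\<bar>(\<Sum>i<k. \<alpha> x (hit E x + i)) - real k * \<theta> x\<bar> \<le> 3 * \<eta> * real b"
            by (simp add: algebra_simps)
        qed
        finally show ?thesis using False by simp
      qed
    qed
  qed (auto intro!: integrable_real_mult_indicator Bochner_Integration.integrable_add simp: emeasure_eq_measure)
  also have "\<dots> = (3 * \<eta> * real b + 1) + real b * prob (bad b) + real b * prob W"
    by (simp add: prob_space emeasure_eq_measure)
  also have "\<dots> < real b * (6 * \<eta>)"
  proof -
    have "real b * prob (bad b) \<le> real b * \<eta>" using bad[of b] E3 by (intro mult_left_mono) auto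
    moreover have "real b * prob W \<le> real b * \<eta>" using W by (intro mult_left_mono) auto
    ultimately show ?thesis using b(1) by (simp add: algebra_simps)
  qed
  finally have "prob (sym_diff A B) < 6 * \<eta>" using b_pos by simp
  then have "prob (sym_diff A B) < e" using \<eta> by simp
  then show ?thesis
    using B n(1,2) Y_meas Y_law close by blast
qed

end

section \<open>The pseudo-metric on measurable sets\<close>

lemma (in finite_measure) Theta_triangle:
  assumes [measurable]: "A \<in> sets M" "B \<in> sets M" "C \<in> sets M"
  shows "Theta M A C \<le> Theta M A B + Theta M B C"
proof -
  have "Theta M A C \<le> measure M (sym_diff A B \<union> sym_diff B C)"
    unfolding Theta_def by (rule finite_measure_mono) auto
  also have "\<dots> \<le> Theta M A B + Theta M B C"
    unfolding Theta_def by (rule measure_Un_le) auto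
  finally show ?thesis .
qed

lemma (in finite_measure) abs_measure_diff_le_Theta:
  assumes [measurable]: "A \<in> sets M" "B \<in> sets M"
  shows "\<bar>measure M A - measure M B\<bar> \<le> Theta M A B"
proof -
  have "measure M A \<le> measure M (B \<union> sym_diff A B)" "measure M B \<le> measure M (A \<union> sym_diff A B)"
    by (rule finite_measure_mono; auto)+
  moreover have "measure M (B \<union> sym_diff A B) \<le> measure M B + Theta M A B"
    "measure M (A \<union> sym_diff A B) \<le> measure M A + Theta M A B"
    unfolding Theta_def by (rule measure_Un_le; auto)+
  ultimately show ?thesis by linarith
qed

lemma (in finite_measure) openin_Theta_ball:
  assumes A: "A \<in> sets M"
  shows "openin (Theta_topology M) {B \<in> sets M. Theta M A B < e}"
  unfolding openin_Theta_topology
proof (intro conjI ballI)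
  fix B assume B: "B \<in> {B \<in> sets M. Theta M A B < e}"
  have "Theta M A C < e" if "C \<in> sets M" "Theta M B C < e - Theta M A B" for C
    using Theta_triangle[of A B C] A B that by auto
  then show "\<exists>d>0. \<forall>C\<in>sets M. Theta M B C < d \<longrightarrow> C \<in> {B \<in> sets M. Theta M A B < e}"
    using B by (intro exI[of _ "e - Theta M A B"]) auto
qed auto

text \<open>The limit is the upper limit of the sets. A point outside all symmetric differences from
  index \<open>n\<close> on has constant membership from then on, so \<open>A n\<close> and
  \<open>L\<close> agree there; countable subadditivity bounds the rest.\<close>

lemma (in finite_measure) Theta_complete:
  assumes A [measurable]: "\<And>n. A n \<in> sets M" and d: "\<And>n. Theta M (A n) (A (Suc n)) \<le> d n" "summable d"
  shows "\<exists>L \<in> sets M. \<forall>n. Theta M (A n) L \<le> (\<Sum>k. d (k + n))"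
proof -
  define L where "L = (\<Inter>n. \<Union>k. A (k + n))"
  have L [measurable]: "L \<in> sets M" unfolding L_def by measurable
  have "Theta M (A n) L \<le> (\<Sum>k. d (k + n))" for n
  proof -
    have const: "x \<in> A (k + n) \<longleftrightarrow> x \<in> A n"
      if "\<And>j. x \<notin> sym_diff (A (j + n)) (A (Suc (j + n)))" for x k
    proof (induction k)
      case (Suc k)
      then show ?case using that[of k] by auto
    qed simp
    have "sym_diff (A n) L \<subseteq> (\<Union>k. sym_diff (A (k + n)) (A (Suc (k + n))))"
    proof (rule subsetI, rule ccontr)
      fix x assume x: "x \<in> sym_diff (A n) L" and "x \<notin> (\<Union>k. sym_diff (A (k + n)) (A (Suc (k + n))))"
      then have c: "\<And>k. x \<in> A (k + n) \<longleftrightarrow> x \<in> A n" by (intro const) blast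
      have "x \<in> L \<longleftrightarrow> x \<in> A n"
      proof
        assume "x \<in> L"
        then obtain k where "x \<in> A (k + n)" unfolding L_def by blast
        then show "x \<in> A n" using c by blast
      next
        assume "x \<in> A n"
        then have "x \<in> A (n + m)" for m using c[of m] by (simp add: add.commute)
        then show "x \<in> L" unfolding L_def by blast
      qed
      with x show False by blast
    qed
    then have "Theta M (A n) L \<le> measure M (\<Union>k. sym_diff (A (k + n)) (A (Suc (k + n))))"
      unfolding Theta_def by (rule finite_measure_mono) auto
    also have sm: "summable (\<lambda>k. measure M (sym_diff (A (k + n)) (A (Suc (k + n)))))"
      by (rule summable_comparison_test'[of "\<lambda>k. d (k + n)" 0])
        (use d in \<open>auto simp: Theta_def summable_iff_shift\<close>)
    have "measure M (\<Union>k. sym_diff (A (k + n)) (A (Suc (k + n))))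
        \<le> (\<Sum>k. measure M (sym_diff (A (k + n)) (A (Suc (k + n)))))"
      by (rule finite_measure_subadditive_countably) (use sm in auto)
    also have "\<dots> \<le> (\<Sum>k. d (k + n))"
      by (rule suminf_le) (use d sm in \<open>auto simp: Theta_def summable_iff_shift\<close>)
    finally show ?thesis .
  qed
  with L show ?thesis by blast
qed

text \<open>Baire's argument with shrinking balls; the geometric decay of the radii makes the
  distances between centres summable, as \<open>Theta_complete\<close> requires.\<close>

lemma (in finite_measure) Theta_Baire:
  fixes U :: "nat \<Rightarrow> 'a set set"
  assumes op: "\<And>n. openin (Theta_topology M) (U n)"
    and dense: "\<And>n A e. A \<in> sets M \<Longrightarrow> e > 0 \<Longrightarrow> \<exists>B \<in> U n. Theta M A B < e"
  shows "Theta_topology M closure_of (\<Inter>n. U n) = sets M"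
proof -
  have U: "U n \<subseteq> sets M" for n using op openin_Theta_topology by blast
  have near: "\<exists>L \<in> (\<Inter>n. U n). Theta M A0 L < e" if A0: "A0 \<in> sets M" and e: "e > 0" for A0 and e :: real
  proof -
    \<comment> \<open>\<open>f n\<close> is a centre with a radius; the ball around the next centre
      lies in \<open>U n\<close>.\<close>
    have "\<exists>f. \<forall>n. (fst (f n) \<in> sets M \<and> snd (f n) > 0 \<and> (n = 0 \<longrightarrow> f n = (A0, e))) \<and>
      (Theta M (fst (f n)) (fst (f (Suc n))) < snd (f n) / 4 \<and> snd (f (Suc n)) \<le> snd (f n) / 4 \<and>
       (\<forall>B \<in> sets M. Theta M (fst (f (Suc n))) B < snd (f (Suc n)) \<longrightarrow> B \<in> U n))"
    proof (rule dependent_nat_choice)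
      show "\<exists>x. fst x \<in> sets M \<and> snd x > 0 \<and> ((0::nat) = 0 \<longrightarrow> x = (A0, e))"
        using A0 e by auto
      fix x :: "'a set \<times> real" and n :: nat
      assume x: "fst x \<in> sets M \<and> snd x > 0 \<and> (n = 0 \<longrightarrow> x = (A0, e))"
      then obtain B where B: "B \<in> U n" "Theta M (fst x) B < snd x / 4"
        using dense[of "fst x" "snd x / 4" n] by auto
      obtain d where d: "d > 0" "\<forall>C \<in> sets M. Theta M B C < d \<longrightarrow> C \<in> U n"
        using op[of n] B(1) unfolding openin_Theta_topology by blast
      show "\<exists>y. (fst y \<in> sets M \<and> snd y > 0 \<and> (Suc n = 0 \<longrightarrow> y = (A0, e))) \<and>
        (Theta M (fst x) (fst y) < snd x / 4 \<and> snd y \<le> snd x / 4 \<and>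
         (\<forall>B \<in> sets M. Theta M (fst y) B < snd y \<longrightarrow> B \<in> U n))"
        by (rule exI[of _ "(B, min d (snd x / 4))"]) (use B d x U in auto)
    qed
    then obtain f where f: "\<And>n. fst (f n) \<in> sets M" "\<And>n. snd (f n) > 0" "f 0 = (A0, e)"
      "\<And>n. Theta M (fst (f n)) (fst (f (Suc n))) < snd (f n) / 4"
      "\<And>n. snd (f (Suc n)) \<le> snd (f n) / 4"
      "\<And>n B. B \<in> sets M \<Longrightarrow> Theta M (fst (f (Suc n))) B < snd (f (Suc n)) \<Longrightarrow> B \<in> U n"
      by blast
    have dec: "snd (f (k + n)) \<le> snd (f n) * (1 / 4) ^ k" for k n
    proof (induction k)
      case (Suc k)
      then show ?case using f(5)[of "k + n"] by simp
    qed simp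
    have geo: "(\<lambda>k. r * (1 / 4) ^ k / 4) sums (r / 3)" for r :: real
      using sums_mult[OF geometric_sums[of "1 / 4 :: real"], of "r / 4"] by (simp add: field_simps)
    have sm: "summable (\<lambda>n. snd (f n) / 4)"
    proof (rule summable_comparison_test'[OF sums_summable[OF geo[of e]], of 0])
      show "norm (snd (f n) / 4) \<le> e * (1 / 4) ^ n / 4" for n
        using dec[of n 0] f(2)[of n] f(3) by simp
    qed
    obtain L where L: "L \<in> sets M" "\<And>n. Theta M (fst (f n)) L \<le> (\<Sum>k. snd (f (k + n)) / 4)"
      using Theta_complete[of "\<lambda>n. fst (f n)" "\<lambda>n. snd (f n) / 4", OF f(1) less_imp_le[OF f(4)] sm]
      by blast
    \<comment> \<open>Quartering the radii keeps the total later movement of the centres within a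
      third of the current radius, so the limit is strictly inside every ball.\<close>
    have close: "Theta M (fst (f n)) L < snd (f n)" for n
    proof -
      have "(\<Sum>k. snd (f (k + n)) / 4) \<le> snd (f n) / 3"
      proof (rule suminf_le[THEN order_trans])
        show "snd (f (k + n)) / 4 \<le> snd (f n) * (1 / 4) ^ k / 4" for k using dec[of k n] by simp
        show "summable (\<lambda>k. snd (f (k + n)) / 4)" using sm by (subst summable_iff_shift)
        show "summable (\<lambda>k. snd (f n) * (1 / 4) ^ k / 4)" using geo sums_summable by blast
        show "(\<Sum>k. snd (f n) * (1 / 4) ^ k / 4) \<le> snd (f n) / 3" using sums_unique[OF geo[of "snd (f n)"]] by simp
      qed
      then show ?thesis using L(2)[of n] f(2)[of n] by simp
    qed
    have "L \<in> U n" for n using f(6)[OF L(1) close] .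
    moreover have "Theta M A0 L < e" using close[of 0] f(3) by simp
    ultimately show ?thesis by blast
  qed
  show ?thesis
  proof (rule antisym)
    show "Theta_topology M closure_of (\<Inter>n. U n) \<subseteq> sets M"
      using closure_of_subset_topspace[of "Theta_topology M"] by simp
    show "sets M \<subseteq> Theta_topology M closure_of (\<Inter>n. U n)"
    proof
      fix A assume A: "A \<in> sets M"
      have "\<exists>y. y \<in> (\<Inter>n. U n) \<and> y \<in> V" if V: "A \<in> V" "openin (Theta_topology M) V" for V
      proof -
        obtain e where e: "e > 0" "\<forall>B \<in> sets M. Theta M A B < e \<longrightarrow> B \<in> V"
          using V unfolding openin_Theta_topology by blast
        obtain L where L: "L \<in> (\<Inter>n. U n)" "Theta M A L < e" using near[OF A e(1)] by blast
        have "L \<in> sets M" using L(1) U by blast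
        then show ?thesis using L e by blast
      qed
      with A show "A \<in> Theta_topology M closure_of (\<Inter>n. U n)"
        by (simp add: in_closure_of)
    qed
  qed
qed

section \<open>Approximation of laws\<close>

text \<open>The empirical distribution function; counting positions gives repeated entries their
  multiplicity.\<close>

definition list_cdf :: "real list \<Rightarrow> real \<Rightarrow> real" where
  "list_cdf l y = real (card {i. i < length l \<and> l ! i \<le> y}) / real (length l)"

lemma sum_list_of_rat: "sum_list (map real_of_rat l) = real_of_rat (sum_list l)"
  by (induction l) (auto simp: of_rat_add)

text \<open>Rational quantiles give the approximation; the last entry, which carries mass at most
  \<open>\<epsilon>\<close>, only serves to make the mean zero.\<close>

lemma (in real_distribution) ex_centred_list:
  assumes \<epsilon>: "\<epsilon> > 0"
  shows "\<exists>l :: rat list. l \<noteq> [] \<and> sum_list l = 0 \<and> (\<forall>y.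
    cdf M (y - \<epsilon>) - \<epsilon> \<le> list_cdf (map real_of_rat l) y \<and> list_cdf (map real_of_rat l) y \<le> cdf M y + \<epsilon>)"
proof -
  define F where "F = cdf M"
  have F01: "0 \<le> F y" "F y \<le> 1" for y by (auto simp: F_def cdf_nonneg cdf_bounded_prob)
  have mono: "F x \<le> F y" if "x \<le> y" for x y unfolding F_def using that by (rule cdf_nondecreasing)
  \<comment> \<open>The witness is a rational above the infimum of the level set
    \<open>{x. p \<le> F x}\<close> by less than \<epsilon>: then some point of the level set is
    below it, and none is below it by \<epsilon> or more.\<close>
  have quantile: "\<exists>q. p \<le> F (real_of_rat q) \<and> F (real_of_rat q - \<epsilon>) < p" if p: "0 < p" "p < 1" for p
  proof -
    have "eventually (\<lambda>x. F x < p) at_bot"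
      unfolding F_def using order_tendstoD(2)[OF cdf_lim_at_bot p(1)] .
    then obtain x1 where x1: "\<And>x. x \<le> x1 \<Longrightarrow> F x < p" unfolding eventually_at_bot_linorder by blast
    have "eventually (\<lambda>x. F x > p) at_top"
      unfolding F_def using order_tendstoD(1)[OF cdf_lim_at_top_prob p(2)] .
    then obtain x2 where x2: "F x2 \<ge> p" by (auto simp: eventually_at_top_linorder intro: less_imp_le)
    define s where "s = Inf {x. p \<le> F x}"
    have bdd: "bdd_below {x. p \<le> F x}"
      using x1 by (intro bdd_belowI[of _ x1]) (metis linorder_not_le mem_Collect_eq nle_le)
    obtain q where q: "s < real_of_rat q" "real_of_rat q < s + \<epsilon>"
      using of_rat_dense[of s "s + \<epsilon>"] \<epsilon> by auto
    obtain x where "p \<le> F x" "x < real_of_rat q"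
      using cInf_lessD[of "{x. p \<le> F x}" "real_of_rat q"] q(1) x2 unfolding s_def by auto
    then have "p \<le> F (real_of_rat q)" using mono[of x "real_of_rat q"] by simp
    moreover have "\<not> p \<le> F (real_of_rat q - \<epsilon>)"
    proof
      assume "p \<le> F (real_of_rat q - \<epsilon>)"
      then have "s \<le> real_of_rat q - \<epsilon>" unfolding s_def using bdd by (intro cInf_lower) auto
      then show False using q by simp
    qed
    ultimately show ?thesis by auto
  qed
  obtain K :: nat where K: "1 / real (K + 1) < \<epsilon>"
    using reals_Archimedean[OF \<epsilon>] by (auto simp: inverse_eq_divide add.commute)
  have "\<forall>i\<in>{..<K}. \<exists>q. real (Suc i) / real (K + 1) \<le> F (real_of_rat q) \<and> F (real_of_rat q - \<epsilon>) < real (Suc i) / real (K + 1)"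
    by (intro ballI quantile) auto
  then obtain q where q: "\<And>i. i < K \<Longrightarrow> real (Suc i) / real (K + 1) \<le> F (real_of_rat (q i))"
      "\<And>i. i < K \<Longrightarrow> F (real_of_rat (q i) - \<epsilon>) < real (Suc i) / real (K + 1)"
    by (metis lessThan_iff)
  define l where "l = map q [0..<K] @ [- sum_list (map q [0..<K])]"
  have len: "length l = K + 1" by (simp add: l_def)
  have nth: "l ! i = q i" if "i < K" for i using that by (simp add: l_def nth_append)
  have "F (y - \<epsilon>) - \<epsilon> \<le> list_cdf (map real_of_rat l) y \<and> list_cdf (map real_of_rat l) y \<le> F y + \<epsilon>" for y
  proof -
    define I where "I = {i. i < length l \<and> map real_of_rat l ! i \<le> y}"
    \<comment> \<open>\<open>Q\<close> leaves out the balancing last entry, which changes the count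
      by at most one.\<close>
    define Q where "Q = {i. i < K \<and> real_of_rat (q i) \<le> y}"
    have sub: "Q \<subseteq> I" "I \<subseteq> insert K Q" unfolding Q_def I_def len by (auto simp: nth len less_Suc_eq)
    have fin: "finite Q" unfolding Q_def by simp
    then have finI: "finite I" using sub(2) by (meson finite.insertI finite_subset)
    have "card I \<le> card (insert K Q)" using sub(2) fin by (intro card_mono) auto
    also have "\<dots> \<le> Suc (card Q)" using fin by (simp add: card_insert_if)
    finally have cI: "card Q \<le> card I" "card I \<le> Suc (card Q)" using card_mono[OF finI sub(1)] by auto
    have "Q \<subseteq> {..<nat \<lfloor>real (K + 1) * F y\<rfloor>}"
    proof
      fix i assume i: "i \<in> Q"
      then have "real (Suc i) / real (K + 1) \<le> F y"
        using q(1)[of i] mono[of "real_of_rat (q i)" y] by (auto simp: Q_def)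
      then have "real (Suc i) \<le> real (K + 1) * F y" by (simp add: field_simps)
      then have "Suc i \<le> nat \<lfloor>real (K + 1) * F y\<rfloor>" by (rule le_nat_floor)
      then show "i \<in> {..<nat \<lfloor>real (K + 1) * F y\<rfloor>}" by simp
    qed
    from card_mono[OF finite_lessThan this] have "card Q \<le> nat \<lfloor>real (K + 1) * F y\<rfloor>"
      by (simp only: card_lessThan)
    also have "real \<dots> \<le> real (K + 1) * F y" using F01[of y] by (intro of_nat_floor) simp
    finally have up: "real (card Q) \<le> real (K + 1) * F y"
      by simp
    have "{..<min K (nat \<lfloor>real (K + 1) * F (y - \<epsilon>)\<rfloor>)} \<subseteq> Q"
    proof
      fix i assume "i \<in> {..<min K (nat \<lfloor>real (K + 1) * F (y - \<epsilon>)\<rfloor>)}"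
      then have i: "i < K" "Suc i \<le> nat \<lfloor>real (K + 1) * F (y - \<epsilon>)\<rfloor>" by auto
      have "real (Suc i) \<le> real (nat \<lfloor>real (K + 1) * F (y - \<epsilon>)\<rfloor>)" using i(2) by (rule of_nat_mono)
      also have "\<dots> \<le> real (K + 1) * F (y - \<epsilon>)" using F01[of "y - \<epsilon>"] by (intro of_nat_floor) simp
      finally have "real (Suc i) \<le> real (K + 1) * F (y - \<epsilon>)" .
      then have "real (Suc i) / real (K + 1) \<le> F (y - \<epsilon>)" by (simp add: field_simps)
      then have "F (real_of_rat (q i) - \<epsilon>) < F (y - \<epsilon>)" using q(2)[OF i(1)] by simp
      then have "real_of_rat (q i) < y" using mono[of "y - \<epsilon>" "real_of_rat (q i) - \<epsilon>"] by linarith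
      with i show "i \<in> Q" by (simp add: Q_def)
    qed
    from card_mono[OF fin this] have "min K (nat \<lfloor>real (K + 1) * F (y - \<epsilon>)\<rfloor>) \<le> card Q"
      by (simp only: card_lessThan)
    \<comment> \<open>For the case in which the minimum above is \<open>K\<close>, that is, all
      quantiles are counted.\<close>
    moreover have "real (K + 1) * F (y - \<epsilon>) - 1 \<le> real K"
    proof -
      have "real (K + 1) * F (y - \<epsilon>) \<le> real (K + 1) * 1" by (intro mult_left_mono F01) simp
      then show ?thesis by (simp only: of_nat_add of_nat_1 mult_1_right)
    qed
    moreover have "real (K + 1) * F (y - \<epsilon>) - 1 \<le> real (nat \<lfloor>real (K + 1) * F (y - \<epsilon>)\<rfloor>)" by linarith
    ultimately have low: "real (K + 1) * F (y - \<epsilon>) - 1 \<le> real (card Q)"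
      unfolding min_le_iff_disj by (elim disjE) linarith+
    have lc: "list_cdf (map real_of_rat l) y = real (card I) / real (K + 1)"
      by (simp add: list_cdf_def I_def len)
    have "F (y - \<epsilon>) - 1 / real (K + 1) = (real (K + 1) * F (y - \<epsilon>) - 1) / real (K + 1)"
      by (simp add: diff_divide_distrib)
    also have "\<dots> \<le> real (card I) / real (K + 1)"
      using low cI(1) by (intro divide_right_mono) linarith+
    finally have "F (y - \<epsilon>) - 1 / real (K + 1) \<le> real (card I) / real (K + 1)" .
    moreover have "real (card I) / real (K + 1) \<le> (real (K + 1) * F y + 1) / real (K + 1)"
      using up cI(2) by (intro divide_right_mono) linarith+
    moreover have "(real (K + 1) * F y + 1) / real (K + 1) = F y + 1 / real (K + 1)"
      by (simp add: add_divide_distrib)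
    ultimately show ?thesis using K unfolding lc by linarith
  qed
  then show ?thesis unfolding F_def by (intro exI[of _ l]) (auto simp: l_def)
qed

text \<open>Shifting the argument absorbs both the error between the law of \<open>Y k\<close> and
  \<nu> and the one between \<open>X k\<close> and \<open>Y k\<close>; at a continuity point the
  shifted bounds squeeze the distribution functions.\<close>

lemma (in prob_space) weak_conv_approx:
  fixes X Y :: "nat \<Rightarrow> 'a \<Rightarrow> real"
  assumes [measurable]: "\<And>k. X k \<in> borel_measurable M" "\<And>k. Y k \<in> borel_measurable M"
    and \<epsilon>: "\<epsilon> \<longlonglongrightarrow> 0"
    and low: "\<And>k y. cdf \<nu> (y - \<epsilon> k) - \<epsilon> k \<le> prob {x \<in> space M. Y k x \<le> y}"
    and up: "\<And>k y. prob {x \<in> space M. Y k x \<le> y} \<le> cdf \<nu> y + \<epsilon> k"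
    and close: "\<And>k. prob {x \<in> space M. \<bar>X k x - Y k x\<bar> > \<epsilon> k} \<le> \<epsilon> k"
  shows "weak_conv_m (\<lambda>k. distr M borel (X k)) \<nu>"
  unfolding weak_conv_m_def weak_conv_def
proof (intro allI impI)
  fix y assume y: "isCont (cdf \<nu>) y"
  have cdf: "cdf (distr M borel (X k)) y = prob {x \<in> space M. X k x \<le> y}" for k
    unfolding cdf_def by (subst measure_distr) (auto intro!: arg_cong[where f=prob])
  have lim: "(\<lambda>k. cdf \<nu> (y + c * \<epsilon> k)) \<longlonglongrightarrow> cdf \<nu> y" for c
  proof (rule isCont_tendsto_compose[OF y])
    show "(\<lambda>k. y + c * \<epsilon> k) \<longlonglongrightarrow> y" using tendsto_add[OF tendsto_const tendsto_mult_left[OF \<epsilon>], of y c] by simp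
  qed
  \<comment> \<open>One shift by \<open>\<epsilon> k\<close> comes from passing to
    \<open>Y k\<close>, the second from \<open>low\<close>; the upper estimate has only the
    first.\<close>
  have lo: "cdf \<nu> (y + (- 2) * \<epsilon> k) - 2 * \<epsilon> k \<le> prob {x \<in> space M. X k x \<le> y}" for k
  proof -
    have "prob {x \<in> space M. Y k x \<le> y - \<epsilon> k}
        \<le> prob ({x \<in> space M. X k x \<le> y} \<union> {x \<in> space M. \<bar>X k x - Y k x\<bar> > \<epsilon> k})"
      by (rule finite_measure_mono) auto
    also have "\<dots> \<le> prob {x \<in> space M. X k x \<le> y} + prob {x \<in> space M. \<bar>X k x - Y k x\<bar> > \<epsilon> k}"
      by (rule measure_Un_le) auto
    finally show ?thesis using low[of "y - \<epsilon> k" k] close[of k] by (simp add: algebra_simps)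
  qed
  have hi: "prob {x \<in> space M. X k x \<le> y} \<le> cdf \<nu> (y + 1 * \<epsilon> k) + 2 * \<epsilon> k" for k
  proof -
    have "prob {x \<in> space M. X k x \<le> y}
        \<le> prob ({x \<in> space M. Y k x \<le> y + \<epsilon> k} \<union> {x \<in> space M. \<bar>X k x - Y k x\<bar> > \<epsilon> k})"
      by (rule finite_measure_mono) auto
    also have "\<dots> \<le> prob {x \<in> space M. Y k x \<le> y + \<epsilon> k} + prob {x \<in> space M. \<bar>X k x - Y k x\<bar> > \<epsilon> k}"
      by (rule measure_Un_le) auto
    finally show ?thesis using up[of k "y + \<epsilon> k"] close[of k] by simp
  qed
  show "(\<lambda>k. cdf (distr M borel (X k)) y) \<longlonglongrightarrow> cdf \<nu> y"
    unfolding cdf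
  proof (rule tendsto_sandwich)
    show "(\<lambda>k. cdf \<nu> (y + (- 2) * \<epsilon> k) - 2 * \<epsilon> k) \<longlonglongrightarrow> cdf \<nu> y"
      using tendsto_diff[OF lim[of "- 2"] tendsto_mult_left[OF \<epsilon>, of 2]] by simp
    show "(\<lambda>k. cdf \<nu> (y + 1 * \<epsilon> k) + 2 * \<epsilon> k) \<longlonglongrightarrow> cdf \<nu> y"
      using tendsto_add[OF lim[of 1] tendsto_mult_left[OF \<epsilon>, of 2]] by simp
  qed (use lo hi in auto)
qed

section \<open>Closeness in law as a stable property of the set\<close>

context mpt
begin

definition normalized_sum :: "(nat \<Rightarrow> real) \<Rightarrow> 'a set \<Rightarrow> nat \<Rightarrow> 'a \<Rightarrow> real" where
  "normalized_sum a A n x = 1 / a n * birkhoff_sum T (\<lambda>y. indicator A y - prob A) n x"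

lemma normalized_sum_measurable [measurable]:
  assumes [measurable]: "A \<in> sets M"
  shows "normalized_sum a A n \<in> borel_measurable M"
  unfolding normalized_sum_def[abs_def] by measurable

text \<open>For fixed \<open>n\<close> the Birkhoff sums of \<open>B\<close> and \<open>C\<close>
  agree unless the orbit meets the symmetric difference within \<open>n\<close> steps, which has
  probability at most \<open>n\<close> times the distance. Hence closeness at \<open>B\<close>
  persists on a ball, at the cost of doubling the tolerance.\<close>

lemma normalized_sum_stable:
  assumes B [measurable]: "B \<in> sets M" and [measurable]: "Y \<in> borel_measurable M"
    and n: "n > 0" "a n > 0" and \<epsilon>: "\<epsilon> > 0"
    and Y: "prob {x \<in> space M. \<bar>normalized_sum a B n x - Y x\<bar> > \<epsilon> / 2} < \<epsilon> / 2"
  shows "\<exists>\<rho>>0. \<forall>C \<in> sets M. Theta M B C < \<rho> \<longrightarrow> prob {x \<in> space M. \<bar>normalized_sum a C n x - Y x\<bar> > \<epsilon>} \<le> \<epsilon>"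
\<comment> \<open>The first term bounds the probability that the sums differ, the second the change
  of the centring divided by \<open>a n\<close>.\<close>
proof (intro exI[of _ "min (\<epsilon> / (2 * real n)) (\<epsilon> * a n / (2 * real n))"] conjI ballI impI)
  show "min (\<epsilon> / (2 * real n)) (\<epsilon> * a n / (2 * real n)) > 0" using n \<epsilon> by simp
  fix C assume C [measurable]: "C \<in> sets M"
    and "Theta M B C < min (\<epsilon> / (2 * real n)) (\<epsilon> * a n / (2 * real n))"
  then have t: "real n * Theta M B C < \<epsilon> / 2" "real n * Theta M B C < \<epsilon> * a n / 2"
    using n by (auto simp: field_simps)
  define D where "D = (\<Union>i<n. {x \<in> space M. (T ^^ i) x \<in> sym_diff B C})"
  have [measurable]: "D \<in> sets M" unfolding D_def by measurable
  have "prob D \<le> (\<Sum>i<n. prob {x \<in> space M. (T ^^ i) x \<in> sym_diff B C})"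
    unfolding D_def by (rule finite_measure_subadditive_finite) auto
  also have "\<dots> = real n * Theta M B C"
    by (simp add: prob_funpow Theta_def del: Diff_iff Un_iff)
  finally have D: "prob D < \<epsilon> / 2" using t by simp
  have "{x \<in> space M. \<bar>normalized_sum a C n x - Y x\<bar> > \<epsilon>}
      \<subseteq> D \<union> {x \<in> space M. \<bar>normalized_sum a B n x - Y x\<bar> > \<epsilon> / 2}"
  proof (rule subsetI, rule ccontr)
    fix x assume x: "x \<in> {x \<in> space M. \<bar>normalized_sum a C n x - Y x\<bar> > \<epsilon>}"
      "x \<notin> D \<union> {x \<in> space M. \<bar>normalized_sum a B n x - Y x\<bar> > \<epsilon> / 2}"
    then have "birkhoff_sum T (indicator C) n x = (birkhoff_sum T (indicator B) n x :: real)"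
      unfolding birkhoff_sum_def D_def by (intro sum.cong) (auto simp: indicator_def)
    then have "normalized_sum a C n x - normalized_sum a B n x = real n * (prob B - prob C) / a n"
      unfolding normalized_sum_def birkhoff_sum_diff_const using n by (simp add: field_simps)
    also have "\<bar>\<dots>\<bar> \<le> real n * Theta M B C / a n"
      using n abs_measure_diff_le_Theta[OF B C]
      by (simp add: abs_mult divide_right_mono mult_left_mono)
    also have "\<dots> \<le> \<epsilon> / 2" using t n by (simp add: divide_le_eq)
    finally have "\<bar>normalized_sum a C n x - normalized_sum a B n x\<bar> \<le> \<epsilon> / 2" .
    moreover from x have "\<bar>normalized_sum a C n x - Y x\<bar> > \<epsilon>" "\<bar>normalized_sum a B n x - Y x\<bar> \<le> \<epsilon> / 2"
      by auto
    ultimately show False by linarith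
  qed
  then have "prob {x \<in> space M. \<bar>normalized_sum a C n x - Y x\<bar> > \<epsilon>}
      \<le> prob (D \<union> {x \<in> space M. \<bar>normalized_sum a B n x - Y x\<bar> > \<epsilon> / 2})"
    by (rule finite_measure_mono) measurable
  also have "\<dots> \<le> prob D + prob {x \<in> space M. \<bar>normalized_sum a B n x - Y x\<bar> > \<epsilon> / 2}"
    by (rule measure_Un_le) auto
  finally show "prob {x \<in> space M. \<bar>normalized_sum a C n x - Y x\<bar> > \<epsilon>} \<le> \<epsilon>" using D Y by simp
qed

text \<open>Closeness in law expressed by a coupling: a variable on the same space has exactly the
  law of the list and approximates the sum in probability.\<close>

definition close_to_list :: "(nat \<Rightarrow> real) \<Rightarrow> real list \<Rightarrow> real \<Rightarrow> nat \<Rightarrow> 'a set \<Rightarrow> bool" where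
  "close_to_list a l \<epsilon> n A \<longleftrightarrow> (\<exists>Y \<in> borel_measurable M.
    (\<forall>y. prob {x \<in> space M. Y x \<le> y} = list_cdf l y) \<and>
    prob {x \<in> space M. \<bar>normalized_sum a A n x - Y x\<bar> > \<epsilon>} \<le> \<epsilon>)"

lemma close_to_list_mono:
  assumes [measurable]: "A \<in> sets M" and "close_to_list a l \<epsilon> n A" "\<epsilon> \<le> \<epsilon>'"
  shows "close_to_list a l \<epsilon>' n A"
proof -
  obtain Y where [measurable]: "Y \<in> borel_measurable M" and Y: "\<forall>y. prob {x \<in> space M. Y x \<le> y} = list_cdf l y"
    "prob {x \<in> space M. \<bar>normalized_sum a A n x - Y x\<bar> > \<epsilon>} \<le> \<epsilon>"
    using assms unfolding close_to_list_def by blast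
  have "prob {x \<in> space M. \<bar>normalized_sum a A n x - Y x\<bar> > \<epsilon>'}
      \<le> prob {x \<in> space M. \<bar>normalized_sum a A n x - Y x\<bar> > \<epsilon>}"
    by (rule finite_measure_mono) (use \<open>\<epsilon> \<le> \<epsilon>'\<close> in auto)
  then show ?thesis
    unfolding close_to_list_def using Y \<open>\<epsilon> \<le> \<epsilon>'\<close> by (intro bexI[of _ Y]) auto
qed

text \<open>Centred rational lists approximate \<nu> with error tending to 0, and for each of them a
  later index is picked at which the sum is close to it.\<close>

lemma ex_weak_conv_subsequence:
  assumes A [measurable]: "A \<in> sets M" and "real_distribution \<nu>"
    and close: "\<And>l :: rat list. \<And>m. l \<noteq> [] \<Longrightarrow> sum_list l = 0 \<Longrightarrow>
      \<exists>n>m. close_to_list a (map real_of_rat l) (1 / real (Suc m)) n A"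
  shows "\<exists>r. strict_mono r \<and> weak_conv_m (\<lambda>k. distr M borel (normalized_sum a A (r k))) \<nu>"
proof -
  interpret \<nu>: real_distribution \<nu> by fact
  define \<epsilon> where "\<epsilon> k = 1 / real (Suc k)" for k
  have "\<forall>k. \<exists>l :: rat list. l \<noteq> [] \<and> sum_list l = 0 \<and> (\<forall>y.
    cdf \<nu> (y - \<epsilon> k) - \<epsilon> k \<le> list_cdf (map real_of_rat l) y \<and> list_cdf (map real_of_rat l) y \<le> cdf \<nu> y + \<epsilon> k)"
    by (intro allI \<nu>.ex_centred_list) (simp add: \<epsilon>_def)
  from choice[OF this] obtain l :: "nat \<Rightarrow> rat list" where l: "\<And>k. l k \<noteq> []" "\<And>k. sum_list (l k) = 0"
    "\<And>k y. cdf \<nu> (y - \<epsilon> k) - \<epsilon> k \<le> list_cdf (map real_of_rat (l k)) y"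
    "\<And>k y. list_cdf (map real_of_rat (l k)) y \<le> cdf \<nu> y + \<epsilon> k"
    by blast
  \<comment> \<open>In \<open>close\<close> the number \<open>m\<close> governs both index and
    tolerance, so \<open>max k N\<close> gives an index beyond \<open>N\<close> and a tolerance of
    at most \<open>\<epsilon> k\<close>.\<close>
  have later: "\<exists>n>N. close_to_list a (map real_of_rat (l k)) (\<epsilon> k) n A" for k N
  proof -
    obtain n where n: "n > max k N" "close_to_list a (map real_of_rat (l k)) (1 / real (Suc (max k N))) n A"
      using close[OF l(1,2)] by blast
    have "close_to_list a (map real_of_rat (l k)) (\<epsilon> k) n A"
      by (rule close_to_list_mono[OF A n(2)]) (auto simp: \<epsilon>_def intro!: divide_left_mono)
    with n show ?thesis by auto
  qed
  have "\<exists>r. \<forall>k. close_to_list a (map real_of_rat (l k)) (\<epsilon> k) (r k) A \<and> r k < r (Suc k)"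
  proof (rule dependent_nat_choice)
    show "\<exists>n. close_to_list a (map real_of_rat (l 0)) (\<epsilon> 0) n A" using later[of 0 0] by blast
    show "\<exists>n. close_to_list a (map real_of_rat (l (Suc k))) (\<epsilon> (Suc k)) n A \<and> N < n" for N k
      using later[of N "Suc k"] by blast
  qed
  then obtain r where r: "\<And>k. close_to_list a (map real_of_rat (l k)) (\<epsilon> k) (r k) A" "\<And>k. r k < r (Suc k)"
    by blast
  have "\<forall>k. \<exists>Y. Y \<in> borel_measurable M \<and>
    (\<forall>y. prob {x \<in> space M. Y x \<le> y} = list_cdf (map real_of_rat (l k)) y) \<and>
    prob {x \<in> space M. \<bar>normalized_sum a A (r k) x - Y x\<bar> > \<epsilon> k} \<le> \<epsilon> k"
    using r(1) unfolding close_to_list_def Bex_def by (rule allI)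
  from choice[OF this] obtain Y where Y: "\<And>k. Y k \<in> borel_measurable M"
    "\<And>k y. prob {x \<in> space M. Y k x \<le> y} = list_cdf (map real_of_rat (l k)) y"
    "\<And>k. prob {x \<in> space M. \<bar>normalized_sum a A (r k) x - Y k x\<bar> > \<epsilon> k} \<le> \<epsilon> k"
    by blast
  have "\<epsilon> \<longlonglongrightarrow> 0" unfolding \<epsilon>_def[abs_def] by (rule LIMSEQ_Suc[OF lim_1_over_n])
  then have "weak_conv_m (\<lambda>k. distr M borel (normalized_sum a A (r k))) \<nu>"
    by (rule weak_conv_approx[rotated 2, of \<epsilon> \<nu> Y]) (use Y l in auto)
  then show ?thesis using r(2) by (auto intro!: exI[of _ r] simp: strict_mono_Suc_iff)
qed

end

section \<open>Intersecting countably many open dense conditions\<close>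

theorem theorem1:
  fixes M :: "'a measure" and T :: "'a \<Rightarrow> 'a" and a :: "nat \<Rightarrow> real"
  assumes "lebesgue_prob_space M" and "non_atomic M"
    and "invertible_measure_preserving M T" and "ergodic M T"
    and "\<And>n. 0 \<le> a n" and "incseq a"
    and "filterlim a at_top sequentially"
    and "(\<lambda>n. a n / real n) \<longlonglongrightarrow> 0"
  shows "\<exists>\<G> :: 'a set set.
    gdelta_in (Theta_topology M) \<G> \<and>
    Theta_topology M closure_of \<G> = topspace (Theta_topology M) \<and>
    (\<forall>A \<in> \<G>. \<forall>\<nu> :: real measure. real_distribution \<nu> \<longrightarrow>
       (\<exists>r :: nat \<Rightarrow> nat. strict_mono r \<and>
          weak_conv_m
            (\<lambda>k. distr M borel
               (\<lambda>x. 1 / a (r k) * birkhoff_sum T (\<lambda>y. indicator A y - measure M A) (r k) x))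
            \<nu>))"
proof -
  interpret prob_space M using assms(1) by (simp add: lebesgue_prob_space_def)
  define T' where "T' = the_inv_into (space M) T"
  have bij: "bij_betw T (space M) (space M)" and T: "T \<in> measurable M M" and T': "T' \<in> measurable M M"
    and pres: "\<And>A. A \<in> sets M \<Longrightarrow> emeasure M (T -` A \<inter> space M) = emeasure M A"
    using assms(3) unfolding invertible_measure_preserving_def T'_def by auto
  interpret invertible_ergodic M T T'
  proof
    show "distr M M T = M" by (rule measure_eqI) (use T pres in \<open>auto simp: emeasure_distr\<close>)
    show "T' (T x) = x" if "x \<in> space M" for x
      unfolding T'_def using bij that by (intro the_inv_into_f_f) (auto simp: bij_betw_def)
    show "T (T' x) = x" if "x \<in> space M" for x
      unfolding T'_def using bij that by (intro f_the_inv_into_f) (auto simp: bij_betw_def)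
  qed (use T T' assms(4) in \<open>auto simp: ergodic_def\<close>)
  obtain g :: "'a \<Rightarrow> real" where g: "g \<in> borel_measurable M" "\<And>c. prob {x \<in> space M. g x = c} = 0"
    using ex_atomless_coordinate[OF assms(1,2)] by blast
  \<comment> \<open>For lists that are empty or not centred the condition is void, so all pairs,
    which form a countable type, can serve as indices.\<close>
  define V where "V l m = {A \<in> sets M. l \<noteq> [] \<and> sum_list l = 0 \<longrightarrow>
    (\<exists>n>m. close_to_list a (map real_of_rat l) (1 / real (Suc m)) n A)}" for l and m :: nat
  \<comment> \<open>Taking interiors makes openness automatic; density then requires a whole ball
    inside \<open>V l m\<close>, which \<open>normalized_sum_stable\<close> supplies around the
    steered set.\<close>
  define U where "U j = Theta_topology M interior_of (case from_nat j of (l, m) \<Rightarrow> V l m)" for j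
  have op: "openin (Theta_topology M) (U j)" for j unfolding U_def by simp
  have dense: "\<exists>B \<in> U j. Theta M A B < e" if A: "A \<in> sets M" and e: "e > 0" for j A e
  proof -
    obtain l :: "rat list" and m :: nat where lm: "from_nat j = (l, m)" by (metis surj_pair)
    have U: "U j = Theta_topology M interior_of V l m" by (simp add: U_def lm)
    show ?thesis
    proof (cases "l \<noteq> [] \<and> sum_list l = 0")
      case False
      then have "V l m = sets M" by (auto simp: V_def)
      then have "U j = sets M" using interior_of_topspace[of "Theta_topology M"] U by simp
      then show ?thesis using A e by (intro bexI[of _ A]) (auto simp: Theta_def)
    next
      case True
      define \<epsilon> where "\<epsilon> = 1 / real (Suc m)"
      have \<epsilon>: "\<epsilon> > 0" by (simp add: \<epsilon>_def)
      have "\<exists>B\<in>sets M. prob (sym_diff A B) < e \<and> (\<exists>n>m. a n > 0 \<and> (\<exists>Y \<in> borel_measurable M.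
        (\<forall>y. prob {x \<in> space M. Y x \<le> y} = list_cdf (map real_of_rat l) y) \<and>
        prob {x \<in> space M. \<bar>normalized_sum a B n x - Y x\<bar> > \<epsilon> / 2} < \<epsilon> / 2))"
        unfolding list_cdf_def normalized_sum_def
        by (rule ex_steered_set[OF g assms(7,8) _ _ A e]) (use True \<epsilon> in \<open>auto simp: sum_list_of_rat\<close>)
      then obtain B n Y where B: "B \<in> sets M" "Theta M A B < e" and n: "n > m" "a n > 0"
        and Y: "Y \<in> borel_measurable M" "\<And>y. prob {x \<in> space M. Y x \<le> y} = list_cdf (map real_of_rat l) y"
        "prob {x \<in> space M. \<bar>normalized_sum a B n x - Y x\<bar> > \<epsilon> / 2} < \<epsilon> / 2"
        unfolding Theta_def by blast
      have "n > 0" using n by simp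
      then obtain \<rho> where \<rho>: "\<rho> > 0" "\<And>C. C \<in> sets M \<Longrightarrow> Theta M B C < \<rho> \<Longrightarrow>
          prob {x \<in> space M. \<bar>normalized_sum a C n x - Y x\<bar> > \<epsilon>} \<le> \<epsilon>"
        using normalized_sum_stable[OF B(1) Y(1) _ n(2) \<epsilon> Y(3)] by blast
      have "{C \<in> sets M. Theta M B C < \<rho>} \<subseteq> V l m"
        using \<rho>(2) Y(1,2) n(1) unfolding V_def close_to_list_def \<epsilon>_def by blast
      moreover have "B \<in> {C \<in> sets M. Theta M B C < \<rho>}" using B \<rho> by (simp add: Theta_def)
      ultimately have "B \<in> U j"
        unfolding U interior_of_def using openin_Theta_ball[OF B(1), of \<rho>] by blast
      with B show ?thesis by blast
    qed
  qed
  show ?thesis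
  proof (intro exI[of _ "\<Inter>j. U j"] conjI ballI allI impI)
    show "gdelta_in (Theta_topology M) (\<Inter>j. U j)"
      by (rule gdelta_in_Inter) (auto intro: open_imp_gdelta_in op)
    show "Theta_topology M closure_of (\<Inter>j. U j) = topspace (Theta_topology M)"
      using Theta_Baire[OF op dense] by simp
    fix A and \<nu> :: "real measure" assume A: "A \<in> (\<Inter>j. U j)" and \<nu>: "real_distribution \<nu>"
    have AV: "A \<in> V l m" for l m
    proof -
      have "A \<in> U (to_nat (l, m))" using A by blast
      then show ?thesis unfolding U_def using interior_of_subset by fastforce
    qed
    then have "A \<in> sets M" by (auto simp: V_def)
    then have "\<exists>r. strict_mono r \<and> weak_conv_m (\<lambda>k. distr M borel (normalized_sum a A (r k))) \<nu>"
      by (rule ex_weak_conv_subsequence[OF _ \<nu>]) (use AV in \<open>auto simp: V_def\<close>)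
    then show "\<exists>r. strict_mono r \<and> weak_conv_m (\<lambda>k. distr M borel
        (\<lambda>x. 1 / a (r k) * birkhoff_sum T (\<lambda>y. indicator A y - prob A) (r k) x)) \<nu>"
      unfolding normalized_sum_def[abs_def] .
  qed
qed

end
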